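(* Let $k\ge1$, $\mathbf{m},\mathbf{n}\in\mathbb{Z}_{\ge0}^k$, $\mathbf{x},\mathbf{y}\in\mathbb{C}^k$, and let $\alpha,\beta\in\mathbb{C}$ with $\Re(\alpha+\beta)>-1$. Then $$\frac{L_{\mathbf{m}}^{(\alpha)}(\mathbf{x})}{\Gamma(\alpha+1+\langle\mathbf{m}\rangle)}\,\frac{L_{\mathbf{n}}^{(\beta)}(\mathbf{y})}{\Gamma(\beta+1+\langle\mathbf{n}\rangle)}=\frac{1}{(2\pi\mathrm{i})^{k+1}}\int_{\mathbb{T}^{k+1}}\omega_{\alpha,\beta}(u)\prod_{r=1}^{k}\omega_{m_r,n_r}(z_r)\cdot\frac{L_{\mathbf{m}+\mathbf{n}}^{(\alpha+\beta)}\big(\widetilde{\xi}_1+\widetilde{\eta}_1,\ldots,\widetilde{\xi}_k+\widetilde{\eta}_k\big)}{\Gamma(\alpha+\beta+\langle\mathbf{m}+\mathbf{n}\rangle+1)}\,\mathrm{d}u\,\mathrm{d}\mathbf{z},$$ where, for $r=1,\ldots,k$, $$\widetilde{\xi}_r:=\frac{1+u}{1+z_r}\cdot\frac{z_r}{u}\cdot x_r,\qquad \widetilde{\eta}_r:=\frac{1+u}{1+z_r}\cdot y_r,$$ and $$\omega_{A,B}(u):=\left(1+\frac{1}{u}\right)^{A}(1+u)^{B}\frac{1}{u}.$$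
   Context: $\mathbb{T}$ is the positively oriented unit circle in $\mathbb{C}$; the integral over $\mathbb{T}^{k+1}$ is over $(u,z_1,\ldots,z_k)$ with $\mathrm{d}\mathbf{z}=\mathrm{d}z_1\cdots\mathrm{d}z_k$. Powers are principal branches, and $1/\Gamma$ is the entire reciprocal gamma function. Boldface letters denote vectors of dimension $k$: $\langle\mathbf{x}\rangle:=x_1+\cdots+x_k$, $\mathbf{x}\circ\mathbf{y}:=(x_1y_1,\ldots,x_ky_k)$, $\mathbf{x}^{\mathbf{n}}:=x_1^{n_1}\cdots x_k^{n_k}$. For every $\alpha\in\mathbb{C}$, Erdélyi's multivariate Laguerre polynomials $L_{\mathbf{n}}^{(\alpha)}(\mathbf{x})=L_{n_1,\ldots,n_k}^{(\alpha)}(x_1,\ldots,x_k)$ ($\mathbf{n}\in\mathbb{Z}_{\ge0}^k$) are defined by $$(1-\langle\mathbf{z}\rangle)^{-\alpha-1}\exp\left\{-\frac{\langle\mathbf{x}\circ\mathbf{z}\rangle}{1-\langle\mathbf{z}\rangle}\right\}=\sum_{\mathbf{n}\in\mathbb{Z}_{\ge0}^k}L_{\mathbf{n}}^{(\alpha)}(\mathbf{x})\,\mathbf{z}^{\mathbf{n}},\qquad |z_1|+\cdots+|z_k|<1.$$ *)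

theory Defs
  imports "HOL-Analysis.Analysis"
begin

definition vsum :: "'a::comm_monoid_add ^ 'k \<Rightarrow> 'a" where
  "vsum x = (\<Sum>r\<in>UNIV. x $ r)"

definition vpow :: "complex ^ 'k \<Rightarrow> nat ^ 'k \<Rightarrow> complex" where
  "vpow x n = (\<Prod>r\<in>UNIV. (x $ r) ^ (n $ r))"

(* The unique coefficient family of the generating function. The product x * z of vectors is
   the componentwise one; the multiple power series is summed unconditionally over all
   multi-indices. As Re (1 - vsum z) > 0 on the given domain, powr is the analytic branch
   that equals 1 at z = 0. *)
definition Laguerre :: "complex \<Rightarrow> nat ^ 'k \<Rightarrow> complex ^ 'k \<Rightarrow> complex" where
  "Laguerre \<alpha> n x =
     (THE L :: nat ^ 'k \<Rightarrow> complex.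
        \<forall>z :: complex ^ 'k. (\<Sum>r\<in>UNIV. norm (z $ r)) < 1 \<longrightarrow>
          ((\<lambda>j. L j * vpow z j) has_sum
             ((1 - vsum z) powr (- \<alpha> - 1) * exp (- (vsum (x * z) / (1 - vsum z))))) UNIV) n"

definition omega :: "complex \<Rightarrow> complex \<Rightarrow> complex \<Rightarrow> complex" where
  "omega A B u = (1 + 1 / u) powr A * (1 + u) powr B * (1 / u)"

definition xi_tilde :: "complex ^ 'k \<Rightarrow> complex \<Rightarrow> complex ^ 'k \<Rightarrow> complex ^ 'k" where
  "xi_tilde x u z = (\<chi> r. (1 + u) / (1 + z $ r) * (z $ r / u) * x $ r)"

definition eta_tilde :: "complex ^ 'k \<Rightarrow> complex \<Rightarrow> complex ^ 'k \<Rightarrow> complex ^ 'k" where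
  "eta_tilde y u z = (\<chi> r. (1 + u) / (1 + z $ r) * y $ r)"

(* The torus is parametrised by u = cis s, z $ r = cis (t $ r), so that
   du = \<i> * cis s ds and dz_r = \<i> * cis (t $ r) dt_r. The integrand is in general only
   defined almost everywhere, namely off u = -1 and z $ r = -1. *)
definition torus_box :: "(real \<times> (real ^ 'k)) set" where
  "torus_box = {- pi..pi} \<times> {t. \<forall>r. t $ r \<in> {- pi..pi}}"

definition torus_pullback ::
    "(complex \<Rightarrow> complex ^ 'k \<Rightarrow> complex) \<Rightarrow> real \<times> (real ^ 'k) \<Rightarrow> complex" where
  "torus_pullback F = (\<lambda>(s, t). F (cis s) (\<chi> r. cis (t $ r)) *
     (\<i> * cis s) * (\<Prod>r\<in>UNIV. \<i> * cis (t $ r)))"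

definition torus_integrable :: "(complex \<Rightarrow> complex ^ 'k \<Rightarrow> complex) \<Rightarrow> bool" where
  "torus_integrable F \<longleftrightarrow> set_integrable lborel torus_box (torus_pullback F)"

definition torus_integral :: "(complex \<Rightarrow> complex ^ 'k \<Rightarrow> complex) \<Rightarrow> complex" where
  "torus_integral F = set_lebesgue_integral lborel torus_box (torus_pullback F)"

end

theory Submission
  imports Defs
begin

text \<open>
  Everything reduces to one integral over the circle: for \<open>Re (A + B) > -1\<close>, the integral of
  \<open>\<omega>\<^sub>A\<^sub>B(u) du / (2\<pi>\<i>)\<close> is \<open>\<Gamma>(A + B + 1) / (\<Gamma>(A + 1) \<Gamma>(B + 1))\<close> (lemma \<open>circle_integral_omega\<close>).

  Multiplied by \<open>1/\<Gamma>(\<alpha> + 1 + \<bar>n\<bar>)\<close>, the Laguerre polynomial of index \<open>n\<close> is the sum over \<open>j \<le> n\<close> of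
  \<open>(-x)\<^sup>j / (j! (n - j)!) / \<Gamma>(\<alpha> + 1 + \<bar>j\<bar>)\<close> (lemma \<open>Laguerre_rGamma\<close>). Expand the polynomial under the integral in
  this way, and each power of a sum \<open>\<xi>\<^sub>r + \<eta>\<^sub>r\<close> by the binomial theorem. In the term that contains
  \<open>x\<^sup>a y\<^sup>b\<close> the factors \<open>((1 + u)/(1 + z\<^sub>r) z\<^sub>r/u)\<close> and \<open>(1 + u)/(1 + z\<^sub>r)\<close> only shift the exponents of the weights:
  the integrand becomes \<open>\<omega>\<close> with exponents \<open>\<alpha> + \<bar>a\<bar>, \<beta> + \<bar>b\<bar>\<close> at \<open>u\<close> times \<open>\<omega>\<close> with exponents
  \<open>m\<^sub>r - a\<^sub>r, n\<^sub>r - b\<^sub>r\<close> at each \<open>z\<^sub>r\<close>. The integral over the torus is therefore a product of circle integrals.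
  Their Gamma values \<open>\<Gamma>(\<alpha> + \<beta> + \<bar>a + b\<bar> + 1)\<close> and \<open>\<Gamma>(m\<^sub>r + n\<^sub>r - a\<^sub>r - b\<^sub>r + 1)\<close> cancel against the coefficients, and the
  reciprocal ones are the coefficients in the product of the two polynomials on the left-hand side; the factors
  \<open>1/\<Gamma>(m\<^sub>r - a\<^sub>r + 1)\<close> and \<open>1/\<Gamma>(n\<^sub>r - b\<^sub>r + 1)\<close> vanish for the superfluous indices.

  The circle integral is evaluated without contour deformation. Integration by parts and the identity
  \<open>(1 + u) + (1 + 1/u) = (1 + u) (1 + 1/u)\<close> yield recurrences in \<open>A\<close> and \<open>B\<close>; as both exponents grow, the integrand
  concentrates at \<open>u = 1\<close>, and comparison with Euler's limit for \<open>1/\<Gamma>\<close> gives the value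
  (lemmas \<open>binomial_moment_step\<close>, \<open>binomial_moment_asymptotics\<close>, \<open>binomial_moment_eq\<close>). The explicit form of the Laguerre
  polynomials comes from expanding the generating function by the binomial and exponential series, together with
  the uniqueness of the coefficients of a multiple power series (lemmas \<open>laguerre_generating_function\<close>,
  \<open>multi_power_series_zero\<close>).
\<close>

section \<open>The weight integrated over the circle\<close>

text \<open>
  For \<open>u = cis s\<close> with \<open>-\<pi> < s < \<pi>\<close> one has \<open>1 + u = 2 cos (s/2) cis (s/2)\<close> and
  \<open>1 + 1/u = 2 cos (s/2) cis (-s/2)\<close>, so that \<open>(1 + 1/u)\<^sup>a (1 + u)\<^sup>b\<close> is the function below at
  \<open>p = a + b\<close>, \<open>q = b - a\<close>. The logarithm is spelled out, rather than hidden in a complex power, so that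
  measurability and the derivative are immediate.
\<close>

definition circle_kernel :: "complex \<Rightarrow> complex \<Rightarrow> real \<Rightarrow> complex" where
  "circle_kernel p q s = exp (p * of_real (ln (2 * cos (s / 2))) + \<i> * q * of_real s / 2)"

abbreviation punctured :: "real set" where
  "punctured \<equiv> {- pi<..<pi}"

definition circle_moment :: "complex \<Rightarrow> complex \<Rightarrow> complex" where
  "circle_moment p q = (LINT s:punctured|lborel. circle_kernel p q s)"

lemma cos_half_pos: "s \<in> punctured \<Longrightarrow> 0 < cos (s / 2)"
  by (rule cos_gt_zero_pi) auto

lemma circle_kernel_measurable [measurable]:
  "circle_kernel p q \<in> borel_measurable borel"
  unfolding circle_kernel_def by measurable

lemma circle_kernel_has_derivative:
  assumes "s \<in> punctured"
  shows "(circle_kernel p q has_vector_derivative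
     (- (p * of_real (tan (s / 2))) + \<i> * q) / 2 * circle_kernel p q s) (at s)"
proof -
  have c: "0 < cos (s / 2)" using cos_half_pos[OF assms] .
  have "((\<lambda>s. ln (2 * cos (s / 2))) has_real_derivative - tan (s / 2) / 2) (at s)"
    using c by (auto intro!: derivative_eq_intros simp: tan_def field_simps)
  then have l: "((\<lambda>s. of_real (ln (2 * cos (s / 2)))) has_vector_derivative
      (of_real (- tan (s / 2) / 2) :: complex)) (at s)"
    by (rule has_vector_derivative_of_real)
  have "((\<lambda>s. p * of_real (ln (2 * cos (s / 2))) + \<i> * q / 2 * of_real s) has_vector_derivative
      p * of_real (- tan (s / 2) / 2) + \<i> * q / 2 * of_real 1) (at s)"
    by (intro has_vector_derivative_add has_vector_derivative_mult_right l
        has_vector_derivative_of_real DERIV_ident)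
  from field_vector_diff_chain_at[OF this DERIV_exp]
  show ?thesis
    unfolding circle_kernel_def o_def by (simp add: field_simps)
qed

lemma norm_circle_kernel:
  "s \<in> punctured \<Longrightarrow> norm (circle_kernel p q s) = (2 * cos (s / 2)) powr Re p * exp (- (Im q * s / 2))"
  using cos_half_pos[of s]
  by (simp add: circle_kernel_def powr_def exp_add [symmetric] del: exp_ln exp_of_real)

lemma norm_circle_kernel_le:
  assumes "s \<in> punctured"
  shows "norm (circle_kernel p q s) \<le> exp (\<bar>Im q\<bar> * pi) * (2 * cos (s / 2)) powr Re p"
proof -
  have "\<bar>Im q * s\<bar> \<le> \<bar>Im q\<bar> * pi"
    using assms by (auto simp: abs_mult intro!: mult_left_mono)
  then have "- (Im q * s / 2) \<le> \<bar>Im q\<bar> * pi"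
    using abs_ge_minus_self [of "Im q * s"] by linarith
  then show ?thesis
    by (subst norm_circle_kernel[OF assms], subst mult.commute, intro mult_right_mono) auto
qed

lemma circle_kernel_shift:
  assumes "s \<in> punctured"
  shows "circle_kernel (p + 1) q s = of_real (2 * cos (s / 2)) * circle_kernel p q s"
    and "circle_kernel p (q + 1) s = exp (\<i> * of_real (s / 2)) * circle_kernel p q s"
    and "circle_kernel p (q - 1) s = exp (- (\<i> * of_real (s / 2))) * circle_kernel p q s"
proof -
  have "exp (of_real (ln (2 * cos (s / 2)))) = (of_real (2 * cos (s / 2)) :: complex)"
    by (subst exp_of_real) (use cos_half_pos[OF assms] in \<open>simp add: exp_ln\<close>)
  then show "circle_kernel (p + 1) q s = of_real (2 * cos (s / 2)) * circle_kernel p q s"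
    by (simp add: circle_kernel_def ring_distribs exp_add)
  show "circle_kernel p (q + 1) s = exp (\<i> * of_real (s / 2)) * circle_kernel p q s"
    unfolding circle_kernel_def exp_add [symmetric] by (rule arg_cong[of _ _ exp]) (simp add: algebra_simps add_divide_distrib)
  show "circle_kernel p (q - 1) s = exp (- (\<i> * of_real (s / 2))) * circle_kernel p q s"
    unfolding circle_kernel_def exp_add [symmetric] by (rule arg_cong[of _ _ exp]) (simp add: algebra_simps diff_divide_distrib)
qed

text \<open>
  These limits are the boundary terms in the integration by parts below. They vanish only for
  \<open>Re p > 0\<close>, which is why it is applied to the kernel with parameter \<open>p + 1\<close>.
\<close>

lemma circle_kernel_vanishes_at_ends:
  assumes "Re p > 0"
  shows "(circle_kernel p q \<longlongrightarrow> 0) (at_left pi)" "(circle_kernel p q \<longlongrightarrow> 0) (at_right (- pi))"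
proof -
  let ?B = "\<lambda>s. exp (\<bar>Im q\<bar> * pi) * (2 * cos (s / 2)) powr Re p"
  have ev: "\<forall>\<^sub>F s in at_left pi. s \<in> punctured" "\<forall>\<^sub>F s in at_right (-pi). s \<in> punctured"
    using eventually_at_leftI[of "-pi" pi "\<lambda>s. s \<in> punctured"]
      eventually_at_rightI[of "-pi" pi "\<lambda>s. s \<in> punctured"] by auto
  have cos_ge: "0 \<le> 2 * cos (s / 2)" if "s \<in> punctured" for s
    using cos_half_pos[OF that] by simp
  have B: "(?B \<longlongrightarrow> 0) (at_left pi)" "(?B \<longlongrightarrow> 0) (at_right (-pi))"
  proof -
    have "((\<lambda>s. 2 * cos (s / 2)) \<longlongrightarrow> 2 * cos (pi / 2)) (at_left pi)"
      by (intro tendsto_intros) auto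
    then have c: "((\<lambda>s. 2 * cos (s / 2)) \<longlongrightarrow> 0) (at_left pi)" by simp
    have "((\<lambda>s. 2 * cos (s / 2)) \<longlongrightarrow> 2 * cos (- pi / 2)) (at_right (-pi))"
      by (intro tendsto_intros) auto
    then have c': "((\<lambda>s. 2 * cos (s / 2)) \<longlongrightarrow> 0) (at_right (-pi))" by simp
    have "((\<lambda>s. (2 * cos (s / 2)) powr Re p) \<longlongrightarrow> 0) (at_left pi)"
      using tendsto_powr'[OF c tendsto_const, of "Re p"] assms eventually_mono[OF ev(1) cos_ge]
      by simp
    then show "(?B \<longlongrightarrow> 0) (at_left pi)" by (rule tendsto_mult_right_zero)
    have "((\<lambda>s. (2 * cos (s / 2)) powr Re p) \<longlongrightarrow> 0) (at_right (-pi))"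
      using tendsto_powr'[OF c' tendsto_const, of "Re p"] assms eventually_mono[OF ev(2) cos_ge]
      by simp
    then show "(?B \<longlongrightarrow> 0) (at_right (-pi))" by (rule tendsto_mult_right_zero)
  qed
  show "(circle_kernel p q \<longlongrightarrow> 0) (at_left pi)"
    by (rule Lim_null_comparison[OF eventually_mono[OF ev(1)] B(1)]) (rule norm_circle_kernel_le)
  show "(circle_kernel p q \<longlongrightarrow> 0) (at_right (-pi))"
    by (rule Lim_null_comparison[OF eventually_mono[OF ev(2)] B(2)]) (rule norm_circle_kernel_le)
qed

text \<open>
  The only difficulty is the endpoint singularity for \<open>c < 0\<close>. As \<open>1 \<le> \<bar>sin\<bar> + cos\<close> on the range of
  \<open>s/2\<close>, the integrand is at most \<open>(2 cos (s/2))\<^sup>c \<bar>sin (s/2)\<bar> + 2\<^sup>c\<close>, and the first summand has the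
  explicit bounded primitive \<open>-(2 cos (s/2))\<^bsup>c+1\<^esup> / (c + 1)\<close> on \<open>(0, \<pi>)\<close>; the left half is its mirror image.
\<close>

lemma two_cos_half_powr_integrable:
  fixes c :: real
  assumes "c > -1"
  shows "set_integrable lborel punctured (\<lambda>s. (2 * cos (s / 2)) powr c)"
proof -
  let ?h = "\<lambda>s. (2 * cos (s / 2)) powr c * sin (s / 2)"
  let ?F = "\<lambda>s. - ((2 * cos (s / 2)) powr (c + 1) / (c + 1))"
  have pos: "0 < cos (s / 2)" if "0 < s" "s < pi" for s
    using cos_half_pos[of s] that by auto
  have "set_integrable lborel (einterval (ereal 0) (ereal pi)) ?h"
  proof (rule interval_integral_FTC_nonneg)
    fix s assume s: "ereal 0 < ereal s" "ereal s < ereal pi"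
    note c = pos[of s]
    have "((\<lambda>s. (2 * cos (s / 2)) powr (c + 1)) has_real_derivative - ((c + 1) * ?h s)) (at s)"
      using c s by (auto intro!: derivative_eq_intros)
    from DERIV_minus[OF DERIV_cdivide[OF this, of "c + 1"]]
    show "(?F has_real_derivative ?h s) (at s)"
      using assms by simp
    show "isCont ?h s"
      using c s by (auto intro!: continuous_intros)
  next
    show "AE s in lborel. ereal 0 < ereal s \<longrightarrow> ereal s < ereal pi \<longrightarrow> 0 \<le> ?h s"
      by (auto intro!: AE_I2 mult_nonneg_nonneg sin_ge_zero)
    have "(?F \<longlongrightarrow> - ((2 * cos (0 / 2)) powr (c + 1) / (c + 1))) (at_right 0)"
      using assms by (intro tendsto_intros) auto
    then show "((?F \<circ> real_of_ereal) \<longlongrightarrow> - (2 powr (c + 1) / (c + 1))) (at_right (ereal 0))"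
      by (simp add: ereal_tendsto_simps)
    have c: "((\<lambda>s. 2 * cos (s / 2)) \<longlongrightarrow> 2 * cos (pi / 2)) (at_left pi)"
      by (intro tendsto_intros) auto
    have "\<forall>\<^sub>F s in at_left pi. 0 \<le> 2 * cos (s / 2)"
      using pos by (intro eventually_at_leftI[of 0]) (auto intro: less_imp_le)
    then have "((\<lambda>s. (2 * cos (s / 2)) powr (c + 1)) \<longlongrightarrow> 0) (at_left pi)"
      using tendsto_powr'[OF c tendsto_const, of "c + 1"] assms by simp
    then have "(?F \<longlongrightarrow> - (0 / (c + 1))) (at_left pi)"
      using assms by (intro tendsto_intros) auto
    then show "((?F \<circ> real_of_ereal) \<longlongrightarrow> 0) (at_left (ereal pi))"
      by (simp add: ereal_tendsto_simps)
  qed simp_all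
  then have right: "integrable lborel (\<lambda>s. indicator {0<..<pi} s *\<^sub>R ?h s)"
    by (simp add: set_integrable_def)
  have left: "integrable lborel (\<lambda>s. indicator {0<..<pi} (- s) *\<^sub>R ?h (- s))"
    using lborel_integrable_real_affine[OF right, of "-1" 0] by simp
  have const: "integrable lborel (\<lambda>s. indicator punctured s *\<^sub>R (2 powr c))"
    using integrable_on_const by (simp add: set_integrable_def)
  show ?thesis
    unfolding set_integrable_def
  proof (rule Bochner_Integration.integrable_bound
      [OF Bochner_Integration.integrable_add[OF Bochner_Integration.integrable_add[OF right left] const]])
    show "AE s in lborel. norm (indicator punctured s *\<^sub>R (2 * cos (s / 2)) powr c)
       \<le> norm (indicator {0<..<pi} s *\<^sub>R ?h s + indicator {0<..<pi} (- s) *\<^sub>R ?h (- s)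
            + indicator punctured s *\<^sub>R (2 powr c))"
    proof (rule AE_I2)
      fix s :: real
      show "norm (indicator punctured s *\<^sub>R (2 * cos (s / 2)) powr c)
       \<le> norm (indicator {0<..<pi} s *\<^sub>R ?h s + indicator {0<..<pi} (- s) *\<^sub>R ?h (- s)
            + indicator punctured s *\<^sub>R (2 powr c))"
      proof (cases "s \<in> punctured")
        case True
        note c = cos_half_pos[OF True]
        have eq: "indicator {0<..<pi} s *\<^sub>R ?h s + indicator {0<..<pi} (- s) *\<^sub>R ?h (- s)
            = (2 * cos (s / 2)) powr c * \<bar>sin (s / 2)\<bar>"
          using True sin_ge_zero[of "s / 2"] sin_ge_zero[of "- (s / 2)"]
          by (cases s "0 :: real" rule: linorder_cases) auto
        have "(2 * cos (s / 2)) powr c * cos (s / 2) = (2 * cos (s / 2)) powr (c + 1) / 2"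
          using c by (simp add: powr_add)
        also have "\<dots> \<le> 2 powr (c + 1) / 2"
          using c assms by (intro divide_right_mono powr_mono2) auto
        finally have cos_le: "(2 * cos (s / 2)) powr c * cos (s / 2) \<le> 2 powr c"
          by (simp add: powr_add)
        have "(\<bar>sin (s / 2)\<bar> + cos (s / 2))\<^sup>2 \<ge> 1"
          using c sin_cos_squared_add[of "s / 2"] by (simp add: power2_sum)
        then have "1 \<le> \<bar>sin (s / 2)\<bar> + cos (s / 2)"
          using c by (smt (verit) abs_ge_zero abs_square_less_1 abs_of_nonneg)
        then have "(2 * cos (s / 2)) powr c * 1 \<le> (2 * cos (s / 2)) powr c * (\<bar>sin (s / 2)\<bar> + cos (s / 2))"
          by (intro mult_left_mono) auto
        also have "\<dots> \<le> (2 * cos (s / 2)) powr c * \<bar>sin (s / 2)\<bar> + 2 powr c"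
          using cos_le by (simp add: ring_distribs)
        finally show ?thesis
          unfolding eq using True by simp
      qed simp
    qed
  qed measurable
qed

lemma circle_kernel_integrable:
  assumes "Re p > -1"
  shows "set_integrable lborel punctured (circle_kernel p q)"
proof (rule set_integrable_bound[OF set_integrable_mult_right
      [OF two_cos_half_powr_integrable[OF assms], of "exp (\<bar>Im q\<bar> * pi)"]])
  show "set_borel_measurable lborel punctured (circle_kernel p q)"
    unfolding set_borel_measurable_def by measurable
  show "AE s in lborel. s \<in> punctured \<longrightarrow> norm (circle_kernel p q s)
      \<le> norm (exp (\<bar>Im q\<bar> * pi) * (2 * cos (s / 2)) powr Re p)"
    using norm_circle_kernel_le by (auto intro!: AE_I2)
qed

text \<open>
  This is \<open>exp (\<i>s/2) + exp (-\<i>s/2) = 2 cos (s/2)\<close> under the integral sign.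
\<close>

lemma circle_moment_add:
  assumes "Re p > -1"
  shows "circle_moment p (q - 1) + circle_moment p (q + 1) = circle_moment (p + 1) q"
proof -
  have "circle_kernel p (q - 1) s + circle_kernel p (q + 1) s = circle_kernel (p + 1) q s"
    if "s \<in> punctured" for s
    unfolding circle_kernel_shift[OF that] distrib_right [symmetric] add.commute[of "exp (- _)"]
    by (simp add: cos_of_real [symmetric] cos_exp_eq)
  then show ?thesis
    unfolding circle_moment_def
    by (subst set_integral_add(2) [symmetric])
       (auto intro!: set_lebesgue_integral_cong circle_kernel_integrable assms)
qed

text \<open>
  Both sides differ by a constant multiple of the integral of the derivative of
  \<open>circle_kernel (p + 1) q\<close>, whose boundary values are zero.
\<close>

lemma circle_moment_parts:
  assumes "Re p > -1"
  shows "(p + 1 + q) * circle_moment p (q + 1) = (p + 1 - q) * circle_moment p (q - 1)"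
proof -
  let ?f = "\<lambda>s. \<i> / 2 * ((p + 1 + q) * circle_kernel p (q + 1) s - (p + 1 - q) * circle_kernel p (q - 1) s)"
  have f_int: "set_integrable lborel punctured ?f"
    using assms by (intro set_integrable_mult_right set_integral_diff circle_kernel_integrable) auto
  have "(LBINT s=ereal (- pi)..ereal pi. ?f s) = 0 - 0"
  proof (rule interval_integral_FTC_integrable)
    fix s assume "ereal (- pi) < ereal s" "ereal s < ereal pi"
    then have s: "s \<in> punctured" by auto
    have e: "2 * sin (of_real (s / 2)) = \<i> * (exp (- (\<i> * of_real (s / 2))) - exp (\<i> * of_real (s / 2)))"
      by (simp add: sin_exp_eq field_simps)
    have "2 * of_real (cos (s / 2)) = exp (\<i> * of_real (s / 2)) + exp (- (\<i> * of_real (s / 2)))"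
      by (simp add: cos_of_real [symmetric] cos_exp_eq)
    moreover have "tan (s / 2) * cos (s / 2) = sin (s / 2)"
      using cos_half_pos[OF s] by (simp add: tan_def)
    then have "2 * (of_real (tan (s / 2)) * of_real (cos (s / 2)))
        = \<i> * (exp (- (\<i> * of_real (s / 2))) - exp (\<i> * of_real (s / 2)))"
      unfolding e [symmetric] by (simp only: of_real_mult [symmetric] sin_of_real)
    ultimately have "(- ((p + 1) * of_real (tan (s / 2))) + \<i> * q) / 2 * circle_kernel (p + 1) q s = ?f s"
      unfolding circle_kernel_shift[OF s] by (simp; algebra)
    then show "(circle_kernel (p + 1) q has_vector_derivative ?f s) (at s)"
      using circle_kernel_has_derivative[OF s, of "p + 1" q] by simp
    show "isCont ?f s"
      by (intro continuous_intros has_vector_derivative_continuous[OF circle_kernel_has_derivative[OF s]])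
  next
    show "set_integrable lborel (einterval (ereal (- pi)) (ereal pi)) ?f"
      using f_int by simp
    show "((circle_kernel (p + 1) q \<circ> real_of_ereal) \<longlongrightarrow> 0) (at_right (ereal (- pi)))"
      "((circle_kernel (p + 1) q \<circ> real_of_ereal) \<longlongrightarrow> 0) (at_left (ereal pi))"
      using assms circle_kernel_vanishes_at_ends[of "p + 1" q] by (simp_all add: ereal_tendsto_simps)
  qed auto
  then have "(LINT s:punctured|lborel. ?f s) = 0"
    by (simp add: interval_lebesgue_integral_def)
  moreover have "(LINT s:punctured|lborel. ?f s) =
      \<i> / 2 * ((p + 1 + q) * circle_moment p (q + 1) - (p + 1 - q) * circle_moment p (q - 1))"
    unfolding circle_moment_def using assms
    by (simp add: set_integral_diff circle_kernel_integrable set_integrable_mult_right)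
  ultimately show ?thesis by simp
qed

text \<open>
  As a function of the exponents in \<open>(1 + 1/u)\<^sup>a (1 + u)\<^sup>b\<close> the integral will turn out to be \<open>2\<pi>\<close> times the
  generalised binomial coefficient of \<open>a + b\<close> over \<open>a\<close>.
\<close>

definition binomial_moment :: "complex \<Rightarrow> complex \<Rightarrow> complex" where
  "binomial_moment a b = circle_moment (a + b) (b - a)"

text \<open>
  The two identities for the moments of \<open>circle_kernel\<close> combine to the contiguity relations that
  \<open>\<Gamma>(a + b + 1) / (\<Gamma>(a + 1) \<Gamma>(b + 1))\<close> satisfies. They are kept free of division because \<open>a + 1\<close> or
  \<open>b + 1\<close> may be zero.
\<close>

lemma binomial_moment_step:
  assumes "Re (a + b) > -1"
  shows "(a + 1) * binomial_moment (a + 1) b = (a + b + 1) * binomial_moment a b"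
    and "(b + 1) * binomial_moment a (b + 1) = (a + b + 1) * binomial_moment a b"
proof -
  have "2 * b * binomial_moment a b = 2 * ((a + 1) * circle_moment (a + b) (b - a - 2))"
    using circle_moment_parts[OF assms, of "b - a - 1"] by (simp add: binomial_moment_def algebra_simps)
  moreover have "binomial_moment (a + 1) b = circle_moment (a + b) (b - a - 2) + binomial_moment a b"
    using circle_moment_add[OF assms, of "b - a - 1"] by (simp add: binomial_moment_def algebra_simps)
  ultimately show "(a + 1) * binomial_moment (a + 1) b = (a + b + 1) * binomial_moment a b"
    by algebra
  have "2 * ((b + 1) * circle_moment (a + b) (b - a + 2)) = 2 * a * binomial_moment a b"
    using circle_moment_parts[OF assms, of "b - a + 1"] by (simp add: binomial_moment_def algebra_simps)
  moreover have "binomial_moment a (b + 1) = binomial_moment a b + circle_moment (a + b) (b - a + 2)"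
    using circle_moment_add[OF assms, of "b - a + 1"] by (simp add: binomial_moment_def algebra_simps)
  ultimately show "(b + 1) * binomial_moment a (b + 1) = (a + b + 1) * binomial_moment a b"
    by algebra
qed

lemma binomial_moment_pochhammer:
  assumes "Re (a + b) > -1"
  shows "pochhammer (a + 1) N * pochhammer (b + 1) N * binomial_moment (a + of_nat N) (b + of_nat N)
    = pochhammer (a + b + 1) (2 * N) * binomial_moment a b"
proof (induction N)
  case (Suc N)
  let ?a = "a + of_nat N" and ?b = "b + of_nat N"
  have "(?a + 1) * binomial_moment (?a + 1) (?b + 1) = (?a + ?b + 2) * binomial_moment ?a (?b + 1)"
    using binomial_moment_step(1)[of ?a "?b + 1"] assms by (simp add: add_ac)
  moreover have "(?b + 1) * binomial_moment ?a (?b + 1) = (?a + ?b + 1) * binomial_moment ?a ?b"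
    using binomial_moment_step(2)[of ?a ?b] assms by simp
  ultimately have "(?a + 1) * (?b + 1) * binomial_moment (?a + 1) (?b + 1)
      = (?a + ?b + 1) * (?a + ?b + 2) * binomial_moment ?a ?b"
    by algebra
  with Suc.IH show ?case
    by (simp add: pochhammer_rec' add_ac; algebra)
qed simp

lemma binomial_moment_0: "binomial_moment 0 0 = 2 * of_real pi"
proof -
  have "circle_kernel 0 0 = (\<lambda>_. 1)" by (simp add: circle_kernel_def fun_eq_iff)
  then show ?thesis
    by (simp add: binomial_moment_def circle_moment_def set_lebesgue_integral_def scaleR_conv_of_real)
qed

lemma binomial_moment_diag: "binomial_moment (of_nat N) (of_nat N) = 2 * of_real pi * fact (2 * N) / (fact N)\<^sup>2"
  using binomial_moment_pochhammer[of 0 0 N]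
  by (simp add: binomial_moment_0 pochhammer_fact [symmetric] field_simps power2_eq_square)

text \<open>
  Raising both exponents by \<open>N\<close> multiplies the kernel by this weight, which concentrates at \<open>s = 0\<close>
  as \<open>N\<close> grows.
\<close>

definition cos_weight :: "nat \<Rightarrow> real \<Rightarrow> real" where
  "cos_weight N s = (2 * cos (s / 2)) ^ (2 * N)"

lemma circle_kernel_shift_nat:
  assumes "s \<in> punctured"
  shows "circle_kernel (p + of_nat k) q s = of_real ((2 * cos (s / 2)) ^ k) * circle_kernel p q s"
proof (induction k)
  case (Suc k)
  then show ?case
    using circle_kernel_shift(1)[OF assms, of "p + of_nat k" q] by (simp add: add_ac)
qed simp

lemma cos_weight_integrable: "set_integrable lborel punctured (cos_weight N)"
proof -
  have "set_integrable lborel {-pi..pi} (cos_weight N)"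
    unfolding cos_weight_def by (intro borel_integrable_atLeastAtMost' continuous_intros) auto
  then show ?thesis by (rule set_integrable_subset) auto
qed

lemma cos_weight_integral:
  "(LINT s:punctured|lborel. cos_weight N s) = 2 * pi * fact (2 * N) / (fact N)\<^sup>2"
proof -
  have "(LINT s:punctured|lborel. of_real (cos_weight N s)) = binomial_moment (of_nat N) (of_nat N)"
    unfolding binomial_moment_def circle_moment_def
  proof (rule set_lebesgue_integral_cong, simp, safe)
    fix s assume "s \<in> punctured"
    from circle_kernel_shift_nat[OF this, of 0 "2 * N" 0]
    show "of_real (cos_weight N s) = circle_kernel (of_nat N + of_nat N) (of_nat N - of_nat N) s"
      by (simp add: cos_weight_def circle_kernel_def)
  qed
  then have "of_real (LINT s:punctured|lborel. cos_weight N s) = (of_real (2 * pi * fact (2 * N) / (fact N)\<^sup>2) :: complex)"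
    using set_integral_complex_of_real[of lborel punctured "cos_weight N"] by (simp add: binomial_moment_diag)
  then show ?thesis by (simp only: of_real_eq_iff)
qed

text \<open>
  The concentration is quantified by the second moment of \<open>sin (s/2)\<close>, in the manner of Korovkin. As
  \<open>sin\<^sup>2 = 1 - cos\<^sup>2\<close>, it is a difference of two consecutive total masses, and these are central
  binomial coefficients up to the factor \<open>2\<pi>\<close>.
\<close>

lemma cos_weight_concentrates:
  "(LINT s:punctured|lborel. cos_weight N s * (sin (s / 2))\<^sup>2)
     = (LINT s:punctured|lborel. cos_weight N s) / (2 * N + 2)"
proof -
  have "cos_weight N s * (sin (s / 2))\<^sup>2 = cos_weight N s - cos_weight (Suc N) s / 4" for s
  proof -
    have "cos_weight (Suc N) s / 4 = cos_weight N s * (cos (s / 2))\<^sup>2"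
      by (simp add: cos_weight_def power2_eq_square)
    then show ?thesis by (simp add: sin_squared_eq right_diff_distrib)
  qed
  then have "(LINT s:punctured|lborel. cos_weight N s * (sin (s / 2))\<^sup>2)
     = (LINT s:punctured|lborel. cos_weight N s) - (LINT s:punctured|lborel. cos_weight (Suc N) s) / 4"
    by (simp add: set_integral_diff cos_weight_integrable)
  also have "\<dots> = (LINT s:punctured|lborel. cos_weight N s) / (2 * N + 2)"
  proof -
    have "fact (2 * Suc N) = (2 * real N + 2) * (2 * real N + 1) * fact (2 * N)"
      and "fact (Suc N) = (real N + 1) * fact N"
      by (simp_all add: algebra_simps)
    then have "(LINT s:punctured|lborel. cos_weight (Suc N) s) / 4
        = ((2 * real N + 2) * (2 * real N + 1) / (4 * (real N + 1)\<^sup>2))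
          * (LINT s:punctured|lborel. cos_weight N s)"
      unfolding cos_weight_integral by (simp add: power_mult_distrib mult_ac add_ac)
    also have "(2 * real N + 2) * (2 * real N + 1) / (4 * (real N + 1)\<^sup>2) = 1 - 1 / (2 * real N + 2)"
      by (simp add: divide_simps power2_eq_square) (simp add: algebra_simps)
    finally have eq: "(LINT s:punctured|lborel. cos_weight (Suc N) s) / 4
        = (1 - 1 / (2 * real N + 2)) * (LINT s:punctured|lborel. cos_weight N s)" .
    show ?thesis unfolding eq by (simp add: left_diff_distrib)
  qed
  finally show ?thesis .
qed

text \<open>
  The quotient is the mean of the kernel against the normalised weight. The kernel is continuous at
  \<open>0\<close> and bounded, so for every
  \<open>e > 0\<close> there is a \<open>K\<close> such that it deviates from its value \<open>2\<^bsup>a+b\<^esup>\<close> there by at most \<open>e + K sin\<^sup>2 (s/2)\<close>, and the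
  mean of \<open>sin\<^sup>2 (s/2)\<close> tends to zero.
\<close>

lemma binomial_moment_asymptotics:
  assumes "Re (a + b) > 0"
  shows "(\<lambda>N. binomial_moment (a + of_nat N) (b + of_nat N) / binomial_moment (of_nat N) (of_nat N))
    \<longlonglongrightarrow> 2 powr (a + b)"
proof (rule LIMSEQ_I)
  fix r :: real assume "r > 0"
  let ?g = "circle_kernel (a + b) (b - a)"
  define W where "W N = (LINT s:punctured|lborel. cos_weight N s)" for N
  have W_pos: "W N > 0" for N unfolding W_def cos_weight_integral by simp
  define C where "C = exp (\<bar>Im (b - a)\<bar> * pi) * 2 powr Re (a + b)"
  have C: "norm (?g s) \<le> C" if "s \<in> punctured" for s
  proof -
    have "(2 * cos (s / 2)) powr Re (a + b) \<le> 2 powr Re (a + b)"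
      using cos_half_pos[OF that] assms by (intro powr_mono2) auto
    then have "exp (\<bar>Im (b - a)\<bar> * pi) * (2 * cos (s / 2)) powr Re (a + b) \<le> C"
      unfolding C_def by (intro mult_left_mono) auto
    then show ?thesis using norm_circle_kernel_le[OF that, of "a + b" "b - a"] by linarith
  qed
  have C0: "C \<ge> 0" by (simp add: C_def)
  define e where "e = r / 2"
  have e: "e > 0" using \<open>r > 0\<close> by (simp add: e_def)
  have zero: "0 \<in> punctured" by simp
  have "isCont ?g 0"
    by (rule has_vector_derivative_continuous[OF circle_kernel_has_derivative[OF zero]])
  then obtain d where d: "d > 0" "\<And>s. \<bar>s\<bar> < d \<Longrightarrow> norm (?g s - ?g 0) < e"
    using e unfolding continuous_at_eps_delta by (auto simp: dist_norm)
  \<comment> \<open>Beyond \<open>\<pi>\<close> the sine of \<open>d/2\<close> would not be monotone in \<open>d\<close>.\<close>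
  define d' where "d' = min d pi"
  have d': "0 < d'" "d' \<le> pi" using d by (auto simp: d'_def)
  have sd: "sin (d' / 2) > 0" using d' by (intro sin_gt_zero) auto
  define K where "K = 2 * C / (sin (d' / 2))\<^sup>2"
  have K0: "K \<ge> 0" using C0 by (simp add: K_def)
  have bound: "norm (?g s - ?g 0) \<le> e + K * (sin (s / 2))\<^sup>2" if s: "s \<in> punctured" for s
  proof (cases "\<bar>s\<bar> < d")
    case True
    then show ?thesis using d(2)[OF True] K0 by (simp add: add_increasing2 less_imp_le)
  next
    case False
    then have "d' \<le> \<bar>s\<bar>" by (simp add: d'_def)
    then have "sin (d' / 2) \<le> sin (\<bar>s\<bar> / 2)"
      using s d' by (intro sin_monotone_2pi_le) auto
    then have "(sin (d' / 2))\<^sup>2 \<le> (sin (\<bar>s\<bar> / 2))\<^sup>2"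
      using sd by (intro power_mono) auto
    also have "\<dots> = (sin (s / 2))\<^sup>2" by (cases "s \<ge> 0") auto
    finally have "K * (sin (d' / 2))\<^sup>2 \<le> K * (sin (s / 2))\<^sup>2"
      using K0 by (rule mult_left_mono)
    moreover have "K * (sin (d' / 2))\<^sup>2 = 2 * C" using sd by (simp add: K_def)
    moreover have "norm (?g s - ?g 0) \<le> 2 * C"
      using C[OF s] C[OF zero] norm_triangle_ineq4[of "?g s" "?g 0"] by linarith
    ultimately show ?thesis using e by linarith
  qed
  have g_int: "set_integrable lborel punctured (\<lambda>s. of_real (cos_weight N s) * ?g s)" for N
  proof -
    have "set_integrable lborel punctured (circle_kernel (a + b + of_nat (2 * N)) (b - a))"
      using assms by (intro circle_kernel_integrable) simp
    then show ?thesis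
      by (rule set_integrable_cong[THEN iffD1, rotated -1])
         (simp_all only: circle_kernel_shift_nat cos_weight_def)
  qed
  have sin_int: "set_integrable lborel punctured (\<lambda>s. cos_weight N s * (sin (s / 2))\<^sup>2)" for N
  proof -
    have "set_integrable lborel {-pi..pi} (\<lambda>s. cos_weight N s * (sin (s / 2))\<^sup>2)"
      unfolding cos_weight_def by (intro borel_integrable_atLeastAtMost' continuous_intros) auto
    then show ?thesis by (rule set_integrable_subset) auto
  qed
  have w_int: "set_integrable lborel punctured (\<lambda>s. of_real (cos_weight N s) * ?g 0)" for N
  proof (intro set_integrable_mult_left)
    from integrable_of_real[OF cos_weight_integrable[of N, unfolded set_integrable_def]]
    show "set_integrable lborel punctured (\<lambda>s. of_real (cos_weight N s) :: complex)"
      by (simp add: set_integrable_def scaleR_conv_of_real)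
  qed
  have est: "norm (binomial_moment (a + of_nat N) (b + of_nat N) - of_real (W N) * ?g 0)
      \<le> (e + K / (2 * N + 2)) * W N" for N
  proof -
    have "binomial_moment (a + of_nat N) (b + of_nat N)
        = (LINT s:punctured|lborel. of_real (cos_weight N s) * ?g s)"
      unfolding binomial_moment_def circle_moment_def
    proof (rule set_lebesgue_integral_cong, simp, safe)
      fix s assume "s \<in> punctured"
      from circle_kernel_shift_nat[OF this, of "a + b" "2 * N" "b - a"]
      show "circle_kernel (a + of_nat N + (b + of_nat N)) (b + of_nat N - (a + of_nat N)) s
          = of_real (cos_weight N s) * ?g s"
        by (simp add: cos_weight_def algebra_simps)
    qed
    moreover have "of_real (W N) * ?g 0 = (LINT s:punctured|lborel. of_real (cos_weight N s) * ?g 0)"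
      unfolding W_def by (simp add: set_integral_complex_of_real [symmetric])
    ultimately have diff: "binomial_moment (a + of_nat N) (b + of_nat N) - of_real (W N) * ?g 0
        = (LINT s:punctured|lborel. of_real (cos_weight N s) * (?g s - ?g 0))"
      using g_int[of N] w_int[of N] by (simp add: right_diff_distrib set_integral_diff(2))
    have d_int: "set_integrable lborel punctured (\<lambda>s. of_real (cos_weight N s) * (?g s - ?g 0))"
      using set_integral_diff(1)[OF g_int[of N] w_int[of N]] by (simp only: right_diff_distrib)
    have dom: "(LINT s:punctured|lborel. norm (of_real (cos_weight N s) * (?g s - ?g 0)))
        \<le> (LINT s:punctured|lborel. e * cos_weight N s + K * (cos_weight N s * (sin (s / 2))\<^sup>2))"
    proof (rule set_integral_mono)
      show "set_integrable lborel punctured (\<lambda>s. norm (of_real (cos_weight N s) * (?g s - ?g 0)))"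
        by (rule set_integrable_norm[OF d_int])
      show "set_integrable lborel punctured (\<lambda>s. e * cos_weight N s + K * (cos_weight N s * (sin (s / 2))\<^sup>2))"
        by (intro set_integral_add set_integrable_mult_right cos_weight_integrable sin_int)
      fix s assume s: "s \<in> punctured"
      have w: "cos_weight N s \<ge> 0" by (simp add: cos_weight_def power_mult)
      have "norm (of_real (cos_weight N s) * (?g s - ?g 0)) = cos_weight N s * norm (?g s - ?g 0)"
        using w by (simp only: norm_mult norm_of_real abs_of_nonneg)
      moreover have "cos_weight N s * norm (?g s - ?g 0) \<le> cos_weight N s * (e + K * (sin (s / 2))\<^sup>2)"
        by (rule mult_left_mono[OF bound[OF s] w])
      moreover have "cos_weight N s * (e + K * (sin (s / 2))\<^sup>2)
          = e * cos_weight N s + K * (cos_weight N s * (sin (s / 2))\<^sup>2)"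
        by (simp add: algebra_simps)
      ultimately show "norm (of_real (cos_weight N s) * (?g s - ?g 0))
          \<le> e * cos_weight N s + K * (cos_weight N s * (sin (s / 2))\<^sup>2)" by linarith
    qed
    have "(LINT s:punctured|lborel. e * cos_weight N s + K * (cos_weight N s * (sin (s / 2))\<^sup>2))
        = e * W N + K * (W N / (2 * N + 2))"
      using cos_weight_integrable[of N] sin_int[of N] cos_weight_concentrates[of N]
      by (simp add: set_integral_add W_def)
    with dom set_integral_norm_bound[OF d_int] show ?thesis
      unfolding diff by (simp add: distrib_right)
  qed
  obtain N0 :: nat where N0: "real N0 > K / e" using reals_Archimedean2 by blast
  have g0: "?g 0 = 2 powr (a + b)"
    using exp_of_real by (simp add: circle_kernel_def powr_def Ln_of_real [symmetric])
  show "\<exists>no. \<forall>N\<ge>no. norm (binomial_moment (a + of_nat N) (b + of_nat N) / binomial_moment (of_nat N) (of_nat N)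
      - 2 powr (a + b)) < r"
  proof (intro exI allI impI)
    fix N assume "N \<ge> N0"
    then have "K / e < real (2 * N + 2)" using N0 by simp
    then have "K / real (2 * N + 2) < e" using e by (simp only: pos_divide_less_eq mult.commute of_nat_0_less_iff)
    then have "K / (2 * N + 2) < e" by simp
    have bw: "binomial_moment (of_nat N) (of_nat N) = of_real (W N)"
      by (simp add: W_def cos_weight_integral binomial_moment_diag)
    have "norm (binomial_moment (a + of_nat N) (b + of_nat N) / of_real (W N) - ?g 0)
        = norm (binomial_moment (a + of_nat N) (b + of_nat N) - of_real (W N) * ?g 0) / W N"
    proof -
      have "binomial_moment (a + of_nat N) (b + of_nat N) / of_real (W N) - ?g 0
          = (binomial_moment (a + of_nat N) (b + of_nat N) - of_real (W N) * ?g 0) / of_real (W N)"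
        using W_pos[of N] by (simp add: diff_divide_distrib)
      then show ?thesis using W_pos[of N] by (simp add: norm_divide)
    qed
    also have "\<dots> \<le> e + K / (2 * N + 2)"
      using est[of N] W_pos[of N] by (simp add: divide_le_eq)
    also have "\<dots> < r" using \<open>K / (2 * N + 2) < e\<close> unfolding e_def by linarith
    finally show "norm (binomial_moment (a + of_nat N) (b + of_nat N) / binomial_moment (of_nat N) (of_nat N)
      - 2 powr (a + b)) < r" unfolding bw g0 .
  qed
qed

text \<open>
  Euler's limit formula for the reciprocal Gamma function, reindexed so that the exponent of \<open>N\<close> is
  \<open>z\<close>; since it concerns \<open>1/\<Gamma>\<close>, no value of \<open>z\<close> is exceptional.
\<close>

lemma pochhammer_asymptotics:
  fixes z :: complex
  shows "(\<lambda>N. pochhammer (z + 1) N / (fact N * exp (z * of_real (ln (of_nat N))))) \<longlonglongrightarrow> rGamma (z + 1)"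
proof -
  \<comment> \<open>\<open>rGamma_series (z + 1) N\<close> has the extra factor \<open>z + 1 + N\<close> and one more power of \<open>N\<close> in the denominator.\<close>
  have "(\<lambda>N. (z + 1) / of_nat N + 1) \<longlonglongrightarrow> 0 + 1"
    by (intro tendsto_intros lim_const_over_n)
  then have "(\<lambda>N. rGamma_series (z + 1) N / ((z + 1) / of_nat N + 1)) \<longlonglongrightarrow> rGamma (z + 1) / (0 + 1)"
    by (intro tendsto_divide rGamma_series_LIMSEQ) auto
  moreover have ev: "\<forall>\<^sub>F N in sequentially. rGamma_series (z + 1) N / ((z + 1) / of_nat N + 1)
      = pochhammer (z + 1) N / (fact N * exp (z * of_real (ln (of_nat N))))"
  proof -
    obtain M :: nat where M: "norm (z + 1) < real M" using reals_Archimedean2 by blast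
    show ?thesis
      using eventually_ge_at_top[of "Suc M"]
    proof eventually_elim
      case (elim N)
      then have N: "norm (z + 1) < real N" "N > 0" using M by auto
      have nz: "z + 1 + of_nat N \<noteq> 0"
      proof
        assume "z + 1 + of_nat N = 0"
        then have "z + 1 = - of_nat N" by (simp add: eq_neg_iff_add_eq_0)
        then have "norm (z + 1) = real N" by (simp only: norm_minus_cancel norm_of_nat)
        with N show False by simp
      qed
      have e: "exp ((z + 1) * of_real (ln (of_nat N))) = exp (z * of_real (ln (of_nat N))) * of_nat N"
      proof -
        have "exp (of_real (ln (of_nat N))) = (of_nat N :: complex)"
          by (subst exp_of_real) (use N in simp)
        then show ?thesis by (simp add: distrib_right exp_add)
      qed
      have "(z + 1) / of_nat N + 1 = (z + 1 + of_nat N) / of_nat N"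
        using N by (simp add: add_divide_distrib)
      have "P * A / (F * (E * n)) / (A / n) = P / (F * E)" if "A \<noteq> 0" "n \<noteq> 0" for P A F E n :: complex
        using that by simp
      from this[OF nz, of "of_nat N" "pochhammer (z + 1) N" "fact N" "exp (z * of_real (ln (of_nat N)))"] N
      show ?case
        unfolding rGamma_series_def e \<open>(z + 1) / of_nat N + 1 = _\<close>
        by (simp add: pochhammer_rec' mult.commute)
    qed
  qed
  ultimately show ?thesis using tendsto_cong[OF ev] by simp
qed

text \<open>
  The contiguity relations determine the integral up to a factor that is periodic in \<open>a\<close> and \<open>b\<close>; the
  behaviour under large simultaneous shifts fixes that factor. The asymptotics need \<open>Re (a + b) > 0\<close>, and
  one more application of the relations extends the formula to \<open>Re (a + b) > -1\<close>.
\<close>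

lemma binomial_moment_eq:
  assumes "Re (a + b) > -1"
  shows "binomial_moment a b = 2 * of_real pi * Gamma (a + b + 1) * rGamma (a + 1) * rGamma (b + 1)"
proof -
  have large: "binomial_moment a b * rGamma (a + b + 1) = 2 * of_real pi * rGamma (a + 1) * rGamma (b + 1)"
    if ab: "Re (a + b) > 0" for a b
  proof -
    let ?p = "\<lambda>z N. pochhammer (z + 1) N / (fact N * exp (z * of_real (ln (of_nat N))) :: complex)"
    let ?R = "\<lambda>N. binomial_moment (a + of_nat N) (b + of_nat N) / binomial_moment (of_nat N) (of_nat N)"
    have sub: "(\<lambda>N. ?p (a + b) (2 * N)) \<longlonglongrightarrow> rGamma (a + b + 1)"
      using LIMSEQ_subseq_LIMSEQ[OF pochhammer_asymptotics, of "(*) 2"] by (simp add: strict_mono_def o_def)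
    have "(\<lambda>N. binomial_moment a b * ?p (a + b) (2 * N) * 2 powr (a + b)) \<longlonglongrightarrow>
        binomial_moment a b * rGamma (a + b + 1) * 2 powr (a + b)"
      by (intro tendsto_intros sub)
    moreover have "(\<lambda>N. 2 * of_real pi * ?p a N * ?p b N * ?R N) \<longlonglongrightarrow>
        2 * of_real pi * rGamma (a + 1) * rGamma (b + 1) * 2 powr (a + b)"
      by (intro tendsto_intros pochhammer_asymptotics binomial_moment_asymptotics ab)
    moreover have ev: "\<forall>\<^sub>F N in sequentially. binomial_moment a b * ?p (a + b) (2 * N) * 2 powr (a + b)
        = 2 * of_real pi * ?p a N * ?p b N * ?R N"
      using eventually_gt_at_top[of 0]
    proof eventually_elim
      case (elim N)
      \<comment> \<open>Bookkeeping of the factors below; \<open>T\<close> is the power of \<open>2\<close> that comes from \<open>2N\<close> in place of \<open>N\<close>.\<close>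
      have alg: "J * (P / (F2 * (T * Ea * Eb))) * T
          = 2 * of_real pi * (Pa / (F * Ea)) * (Pb / (F * Eb)) * (X / (2 * of_real pi * F2 / F\<^sup>2))"
        if "J * P = Pa * Pb * X" "F \<noteq> 0" "F2 \<noteq> 0" "T \<noteq> 0" "Ea \<noteq> 0" "Eb \<noteq> 0"
        for J P F F2 T Ea Eb Pa Pb X :: complex
      proof -
        have "J * (P / (F2 * (T * Ea * Eb))) * T = J * P / (F2 * Ea * Eb)"
          using that by (simp add: mult.assoc)
        also have "\<dots> = 2 * of_real pi * (Pa / (F * Ea)) * (Pb / (F * Eb)) * (X / (2 * of_real pi * F2 / F\<^sup>2))"
          unfolding that(1) using that(2-) by (simp add: power2_eq_square mult_ac)
        finally show ?thesis .
      qed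
      have "ln (real (2 * N)) = ln 2 + ln (real N)" using elim by (simp add: ln_mult)
      then have E: "exp ((a + b) * of_real (ln (of_nat (2 * N)))) = 2 powr (a + b)
          * exp (a * of_real (ln (of_nat N))) * exp (b * of_real (ln (of_nat N)))"
        using Ln_of_real[of 2] by (simp add: powr_def exp_add distrib_left distrib_right)
      show ?case
        unfolding binomial_moment_diag E
        by (rule alg) (use binomial_moment_pochhammer[of a b N] ab in \<open>simp_all add: mult.commute\<close>)
    qed
    ultimately have "binomial_moment a b * rGamma (a + b + 1) * 2 powr (a + b)
        = 2 * of_real pi * rGamma (a + 1) * rGamma (b + 1) * 2 powr (a + b)"
      using LIMSEQ_unique unfolding tendsto_cong[OF ev] by blast
    then show ?thesis by simp
  qed
  have "(a + b + 1) * (a + b + 2) * binomial_moment a b = (a + 1) * (b + 1) * binomial_moment (a + 1) (b + 1)"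
    using binomial_moment_pochhammer[OF assms, of 1] by (simp add: pochhammer_rec numeral_2_eq_2 add_ac)
  moreover have "binomial_moment (a + 1) (b + 1) * rGamma (a + b + 3)
      = 2 * of_real pi * rGamma (a + 2) * rGamma (b + 2)"
    using large[of "a + 1" "b + 1"] assms by (simp add: add_ac)
  moreover have "rGamma (a + 1) = (a + 1) * rGamma (a + 2)" "rGamma (b + 1) = (b + 1) * rGamma (b + 2)"
    "rGamma (a + b + 1) = (a + b + 1) * rGamma (a + b + 2)"
    "rGamma (a + b + 2) = (a + b + 2) * rGamma (a + b + 3)"
    using rGamma_plus1[of "a + 1"] rGamma_plus1[of "b + 1"]
      rGamma_plus1[of "a + b + 1"] rGamma_plus1[of "a + b + 2"] by (simp_all add: add.assoc)
  ultimately have "binomial_moment a b * rGamma (a + b + 1) = 2 * of_real pi * rGamma (a + 1) * rGamma (b + 1)"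
    by algebra
  moreover have "a + b + 1 \<notin> \<int>\<^sub>\<le>\<^sub>0"
    using assms by (auto elim!: nonpos_Ints_cases simp: complex_eq_iff)
  then have "Gamma (a + b + 1) * rGamma (a + b + 1) = 1"
    by (simp add: rGamma_inverse_Gamma Gamma_eq_zero_iff)
  ultimately show ?thesis by algebra
qed

lemma one_plus_cis:
  assumes "s \<in> punctured"
  shows "1 + cis s = exp (of_real (ln (2 * cos (s / 2))) + \<i> * of_real (s / 2))"
    and "1 + 1 / cis s = exp (of_real (ln (2 * cos (s / 2))) - \<i> * of_real (s / 2))"
proof -
  define E E' where "E = exp (\<i> * of_real (s / 2))" and "E' = exp (- (\<i> * of_real (s / 2)))"
  have r: "exp (of_real (ln (2 * cos (s / 2)))) = E + E'"
  proof -
    have "exp (of_real (ln (2 * cos (s / 2)))) = (of_real (2 * cos (s / 2)) :: complex)"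
      using cos_half_pos[OF assms] by (subst exp_of_real) simp
    also have "\<dots> = E + E'"
      by (simp add: E_def E'_def cos_of_real [symmetric] cos_exp_eq)
    finally show ?thesis .
  qed
  have inv: "E * E' = 1" unfolding E_def E'_def by (rule exp_minus_inverse)
  have E2: "E * E = cis s"
    unfolding E_def exp_add [symmetric] cis_conv_exp by (rule arg_cong[of _ _ exp]) simp
  have "1 + cis s = (E + E') * E"
    using inv E2 by algebra
  then show "1 + cis s = exp (of_real (ln (2 * cos (s / 2))) + \<i> * of_real (s / 2))"
    by (simp only: exp_add r E_def [symmetric])
  have "E' * E' * cis s = 1"
    using inv E2 by algebra
  then have "1 / cis s = E' * E'"
    by (simp add: divide_eq_eq)
  then have "1 + 1 / cis s = (E + E') * E'"
    using inv by algebra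
  then show "1 + 1 / cis s = exp (of_real (ln (2 * cos (s / 2))) - \<i> * of_real (s / 2))"
    by (simp only: diff_conv_add_uminus exp_add r E'_def [symmetric])
qed

lemma omega_cis:
  assumes "s \<in> punctured"
  shows "omega a b (cis s) * (\<i> * cis s) = \<i> * circle_kernel (a + b) (b - a) s"
proof -
  let ?l = "of_real (ln (2 * cos (s / 2))) :: complex"
  have L: "Ln (1 + cis s) = ?l + \<i> * of_real (s / 2)" "Ln (1 + 1 / cis s) = ?l - \<i> * of_real (s / 2)"
    unfolding one_plus_cis[OF assms] using assms by (auto intro!: Ln_exp)
  have nz: "1 + cis s \<noteq> 0" "1 + 1 / cis s \<noteq> 0"
    unfolding one_plus_cis[OF assms] by simp_all
  have "(1 + 1 / cis s) powr a * (1 + cis s) powr b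
      = exp (a * (?l - \<i> * of_real (s / 2)) + b * (?l + \<i> * of_real (s / 2)))"
    by (simp only: powr_def nz if_False L exp_add)
  also have "\<dots> = circle_kernel (a + b) (b - a) s"
    unfolding circle_kernel_def by (rule arg_cong[of _ _ exp]) (simp add: algebra_simps diff_divide_distrib)
  finally have "(1 + 1 / cis s) powr a * (1 + cis s) powr b = circle_kernel (a + b) (b - a) s" .
  moreover have "X * Y * (1 / c) * (\<i> * c) = \<i> * (X * Y)" if "c \<noteq> 0" for X Y c :: complex
    using that by simp
  from this[OF cis_neq_zero]
  have "omega a b (cis s) * (\<i> * cis s) = \<i> * ((1 + 1 / cis s) powr a * (1 + cis s) powr b)"
    unfolding omega_def .
  ultimately show ?thesis by simp
qed

text \<open>
  The value of a complex power at the base \<open>0\<close> is \<open>0\<close>, whatever the exponent. Hence the weights vanish at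
  \<open>u = -1\<close>, and identities between them that hold off this point extend to the whole circle.
\<close>

lemma omega_minus_one [simp]: "omega a b (- 1) = 0"
  by (simp add: omega_def)

lemma circle_integral_omega:
  assumes "Re (a + b) > -1"
  shows "set_integrable lborel {- pi..pi} (\<lambda>s. omega a b (cis s) * (\<i> * cis s))"
    and "(LINT s:{- pi..pi}|lborel. omega a b (cis s) * (\<i> * cis s))
      = 2 * of_real pi * \<i> * (Gamma (a + b + 1) * rGamma (a + 1) * rGamma (b + 1))"
proof -
  have eq: "indicator {- pi..pi} s *\<^sub>R (omega a b (cis s) * (\<i> * cis s))
      = indicator punctured s *\<^sub>R (\<i> * circle_kernel (a + b) (b - a) s)" for s
  proof (cases "s \<in> punctured")
    case False
    then consider "s \<notin> {- pi..pi}" | "s = pi" | "s = - pi" by force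
    moreover have "cis (- pi) = - 1" by (simp add: complex_eq_iff)
    ultimately show ?thesis by cases (use False in auto)
  qed (use omega_cis[of s a b] in auto)
  have "set_integrable lborel punctured (\<lambda>s. \<i> * circle_kernel (a + b) (b - a) s)"
    by (intro set_integrable_mult_right circle_kernel_integrable assms)
  then show "set_integrable lborel {- pi..pi} (\<lambda>s. omega a b (cis s) * (\<i> * cis s))"
    unfolding set_integrable_def eq .
  have "(LINT s:{- pi..pi}|lborel. omega a b (cis s) * (\<i> * cis s))
      = (LINT s:punctured|lborel. \<i> * circle_kernel (a + b) (b - a) s)"
    unfolding set_lebesgue_integral_def eq ..
  also have "\<dots> = \<i> * binomial_moment a b"
    by (simp add: binomial_moment_def circle_moment_def)
  finally show "(LINT s:{- pi..pi}|lborel. omega a b (cis s) * (\<i> * cis s))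
      = 2 * of_real pi * \<i> * (Gamma (a + b + 1) * rGamma (a + 1) * rGamma (b + 1))"
    by (simp add: binomial_moment_eq[OF assms])
qed

section \<open>Multiple power series\<close>

text \<open>
  The monomial \<open>z\<^sup>p / p!\<close>: with this normalisation both the binomial theorem for vectors and the
  multinomial theorem have no coefficients.
\<close>

definition divided_power :: "'a::real_normed_field ^ 'k \<Rightarrow> nat ^ 'k \<Rightarrow> 'a" where
  "divided_power z p = (\<Prod>r\<in>UNIV. z $ r ^ (p $ r) / fact (p $ r))"

text \<open>
  The induction over the set of variables needs multi-indices supported on a subset; these are easier to handle as
  functions than as vectors. The inductive step splits off the exponent of the new variable and is the binomial
  theorem. Finiteness of the index set is carried along since the inductive step has to interchange sums.
\<close>

lemma multinomial_on:
  fixes z :: "'k \<Rightarrow> 'a::field_char_0"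
  assumes "finite A"
  shows "finite {p. (\<forall>r. r \<notin> A \<longrightarrow> p r = 0) \<and> sum p A = (N :: nat)}
    \<and> (\<Sum>p | (\<forall>r. r \<notin> A \<longrightarrow> p r = 0) \<and> sum p A = N. \<Prod>r\<in>A. z r ^ p r / fact (p r))
      = (\<Sum>r\<in>A. z r) ^ N / fact N"
  using assms
proof (induction A arbitrary: N rule: finite_induct)
  case empty
  have "{p :: 'k \<Rightarrow> nat. \<forall>r. p r = 0} = {\<lambda>r. 0}" by auto
  then show ?case by (cases N) simp_all
next
  case (insert q A)
  let ?X = "\<lambda>A N. {p :: 'k \<Rightarrow> nat. (\<forall>r. r \<notin> A \<longrightarrow> p r = 0) \<and> sum p A = N}"
  let ?w = "\<lambda>A p. \<Prod>r\<in>A. z r ^ p r / fact (p r)"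
  let ?S = "Sigma {..N} (\<lambda>i. ?X A (N - i))"
  have sum_upd: "(\<Sum>r\<in>A. if r = q then i else p r) = sum p A" for p :: "'k \<Rightarrow> nat" and i
    using insert.hyps by (intro sum.cong) auto
  have prod_upd: "(\<Prod>r\<in>A. z r ^ (if r = q then i else p r) / fact (if r = q then i else p r)) = ?w A p" for p i
    using insert.hyps by (intro prod.cong) auto
  have bij: "bij_betw (\<lambda>(i, p). p(q := i)) ?S (?X (insert q A) N)"
    by (rule bij_betw_byWitness[where f' = "\<lambda>p. (p q, p(q := 0))"])
       (use insert.hyps in \<open>auto simp: sum_upd\<close>)
  have finX: "finite (?X A M)" for M using insert.IH by blast
  then have fin: "finite ?S" by auto
  have "(\<Sum>p\<in>?X (insert q A) N. ?w (insert q A) p)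
      = (\<Sum>(i, p)\<in>?S. z q ^ i / fact i * ?w A p)"
    using insert.hyps by (subst sum.reindex_bij_betw[OF bij, symmetric])
      (simp add: prod_upd case_prod_beta)
  also have "\<dots> = (\<Sum>i\<le>N. z q ^ i / fact i * (\<Sum>p\<in>?X A (N - i). ?w A p))"
    using finX by (subst sum.Sigma [symmetric]) (simp_all add: sum_distrib_left)
  also have "\<dots> = (\<Sum>i\<le>N. z q ^ i / fact i * ((\<Sum>r\<in>A. z r) ^ (N - i) / fact (N - i)))"
    using insert.IH by simp
  also have "\<dots> = (z q + (\<Sum>r\<in>A. z r)) ^ N / fact N"
    unfolding binomial_ring sum_divide_distrib
    by (intro sum.cong) (auto simp: binomial_fact)
  finally have val: "(\<Sum>p\<in>?X (insert q A) N. ?w (insert q A) p) = (z q + (\<Sum>r\<in>A. z r)) ^ N / fact N" .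
  have eq: "(\<Sum>r\<in>insert q A. z r) = z q + (\<Sum>r\<in>A. z r)"
    using insert.hyps by simp
  show ?case
    unfolding eq
  proof
    show "finite (?X (insert q A) N)" by (rule bij_betw_finite[OF bij, THEN iffD1, OF fin])
  qed (rule val)
qed

lemma multinomial:
  fixes z :: "'a::real_normed_field ^ 'k"
  shows "finite {p :: nat ^ 'k. vsum p = N}"
    and "(\<Sum>p | vsum p = N. divided_power z p) = vsum z ^ N / fact N"
proof -
  have bij: "bij_betw vec_lambda {p :: 'k \<Rightarrow> nat. (\<forall>r. r \<notin> UNIV \<longrightarrow> p r = 0) \<and> sum p UNIV = N}
      {p :: nat ^ 'k. vsum p = N}"
    by (rule bij_betw_byWitness[where f' = vec_nth]) (auto simp: vsum_def)
  show "finite {p :: nat ^ 'k. vsum p = N}"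
    using bij_betw_finite[OF bij] conjunct1[OF multinomial_on[OF finite, of UNIV N "vec_nth z"]] by simp
  show "(\<Sum>p | vsum p = N. divided_power z p) = vsum z ^ N / fact N"
    using conjunct2[OF multinomial_on[OF finite, of UNIV N "vec_nth z"]]
    by (subst sum.reindex_bij_betw[OF bij, symmetric]) (simp add: divided_power_def vsum_def)
qed

lemma bij_betw_graph: "bij_betw (\<lambda>x. (f x, x)) X (Sigma UNIV (\<lambda>i. {x \<in> X. f x = i}))"
  by (rule bij_betw_byWitness[where f' = snd]) auto

text \<open>
  A series over multi-indices is summed degree by degree: first over the finite set of indices of given
  degree, then over the degree. The next two lemmas do this for nonnegative and for summable families.
\<close>

lemma summable_on_by_degree:
  fixes f :: "nat ^ 'k \<Rightarrow> real"
  assumes "\<And>p. f p \<ge> 0" and "summable (\<lambda>N. \<Sum>p | vsum p = N. f p)"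
  shows "f summable_on UNIV"
proof -
  have "(f \<circ> snd) summable_on Sigma UNIV (\<lambda>N. {p :: nat ^ 'k. vsum p = N})"
  proof (rule summable_on_SigmaI)
    show "((\<lambda>p. (f \<circ> snd) (N, p)) has_sum (\<Sum>p | vsum p = N. f p)) {p. vsum p = N}" for N
      by (simp add: has_sum_finite multinomial(1))
    show "(\<lambda>N. \<Sum>p | vsum p = N. f p) summable_on UNIV"
      by (intro summable_nonneg_imp_summable_on assms sum_nonneg)
  qed (use assms in auto)
  moreover have "bij_betw (\<lambda>p :: nat ^ 'k. (vsum p, p)) UNIV (Sigma UNIV (\<lambda>N. {p. vsum p = N}))"
    using bij_betw_graph[of vsum UNIV] by simp
  from summable_on_reindex_bij_betw[OF this, of "f \<circ> snd"]
  have "(f \<circ> snd) summable_on Sigma UNIV (\<lambda>N. {p :: nat ^ 'k. vsum p = N}) \<longleftrightarrow> f summable_on UNIV"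
    by (simp add: o_def)
  ultimately show ?thesis by simp
qed

lemma sums_by_degree:
  fixes f :: "nat ^ 'k \<Rightarrow> 'a::banach"
  assumes "f summable_on UNIV" and "(\<lambda>N. \<Sum>p | vsum p = N. f p) sums S"
  shows "(f has_sum S) UNIV"
proof -
  have bij: "bij_betw (\<lambda>p :: nat ^ 'k. (vsum p, p)) UNIV (Sigma UNIV (\<lambda>N. {p. vsum p = N}))"
    using bij_betw_graph[of vsum UNIV] by simp
  obtain T where T: "(f has_sum T) UNIV" using assms(1) by (auto simp: summable_on_def)
  then have "((f \<circ> snd) has_sum T) (Sigma UNIV (\<lambda>N. {p :: nat ^ 'k. vsum p = N}))"
    using has_sum_reindex_bij_betw[OF bij, of "f \<circ> snd" T] by (simp add: o_def)
  then have "((\<lambda>N. \<Sum>p | vsum p = N. f p) has_sum T) UNIV"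
    by (rule has_sum_SigmaD) (simp add: has_sum_finite multinomial(1))
  then have "(\<lambda>N. \<Sum>p | vsum p = N. f p) sums T" by (rule has_sum_imp_sums)
  then show ?thesis using T assms(2) sums_unique2 by blast
qed

lemma norm_divided_power: "norm (divided_power z p) = divided_power (\<chi> r. norm (z $ r)) p"
  by (simp add: divided_power_def prod_norm [symmetric] norm_divide norm_power)

lemma divided_power_nonneg: "(\<And>r. 0 \<le> (z :: real ^ 'k) $ r) \<Longrightarrow> 0 \<le> divided_power z p"
  by (simp add: divided_power_def prod_nonneg)

lemma sum_degree_divided_power:
  "(\<Sum>p | vsum p = N. c (vsum p) * divided_power z p) = c N * vsum z ^ N / fact N"
  using multinomial(2)[of z N] by (simp add: sum_distrib_left [symmetric])

text \<open>
  By the multinomial theorem a multiple power series whose coefficients depend on the degree only (up to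
  the factor \<open>1/p!\<close>) is a power series in the single variable \<open>vsum z\<close>.
\<close>

lemma degree_series:
  fixes z :: "'a::{real_normed_field, banach} ^ 'k" and c :: "nat \<Rightarrow> 'a"
  assumes "summable (\<lambda>N. norm (c N) * (\<Sum>r\<in>UNIV. norm (z $ r)) ^ N / fact N)"
    and "(\<lambda>N. c N * vsum z ^ N / fact N) sums S"
  shows "((\<lambda>p. c (vsum p) * divided_power z p) has_sum S) UNIV"
proof (rule sums_by_degree)
  have "(\<lambda>p. norm (c (vsum p)) * divided_power (\<chi> r. norm (z $ r)) p) summable_on UNIV"
  proof (rule summable_on_by_degree)
    show "0 \<le> norm (c (vsum p)) * divided_power (\<chi> r. norm (z $ r)) p" for p
      by (intro mult_nonneg_nonneg divided_power_nonneg) auto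
    show "summable (\<lambda>N. \<Sum>p | vsum p = N. norm (c (vsum p)) * divided_power (\<chi> r. norm (z $ r)) p)"
      unfolding sum_degree_divided_power[where c = "\<lambda>N. norm (c N)"]
      using assms(1) by (simp add: vsum_def)
  qed
  then show "(\<lambda>p. c (vsum p) * divided_power z p) summable_on UNIV"
    by (rule abs_summable_summable[OF summable_on_cong[THEN iffD1, rotated]]) (simp add: norm_mult norm_divided_power)
  show "(\<lambda>N. \<Sum>p | vsum p = N. c (vsum p) * divided_power z p) sums S"
    using assms(2) by (simp only: sum_degree_divided_power)
qed

lemma binomial_series_pochhammer:
  fixes a s :: complex
  assumes "norm s < 1"
  shows "(\<lambda>N. pochhammer a N * s ^ N / fact N) sums (1 - s) powr (- a)"
proof -
  have "(- a gchoose N) * (- s) ^ N = pochhammer a N * s ^ N / fact N" for N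
    unfolding power_minus[of s N] by (simp add: gbinomial_pochhammer)
  then show ?thesis using gen_binomial_complex[of "- s" "- a"] assms by simp
qed

lemma binomial_series_pochhammer_real:
  fixes a s :: real
  assumes "\<bar>s\<bar> < 1"
  shows "(\<lambda>N. pochhammer a N * s ^ N / fact N) sums (1 - s) powr (- a)"
proof -
  have "(- a gchoose N) * (- s) ^ N = pochhammer a N * s ^ N / fact N" for N
    unfolding power_minus[of s N] by (simp add: gbinomial_pochhammer)
  then show ?thesis using gen_binomial_real[of "- s" "- a"] assms by simp
qed

lemma norm_pochhammer_le:
  fixes z :: "'a::real_normed_field"
  assumes "norm z \<le> a"
  shows "norm (pochhammer z N) \<le> pochhammer a N"
proof (induction N)
  case (Suc N)
  have "norm (z + of_nat N) \<le> a + of_nat N"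
    using assms norm_triangle_ineq[of z "of_nat N"] by simp
  then show ?case
    unfolding pochhammer_rec' norm_mult
    using Suc.IH order_trans[OF norm_ge_zero assms] by (intro mult_mono) auto
qed simp

lemma summable_norm_pochhammer:
  fixes a :: "'a::real_normed_field" and s :: real
  assumes "0 \<le> s" "s < 1"
  shows "summable (\<lambda>N. norm (pochhammer a N) * s ^ N / fact N)"
proof (rule summable_comparison_test'[of _ 0])
  show "summable (\<lambda>N. pochhammer (norm a) N * s ^ N / fact N)"
    using assms by (intro sums_summable[OF binomial_series_pochhammer_real]) auto
  fix N
  have "norm (norm (pochhammer a N) * s ^ N / fact N) = norm (pochhammer a N) * s ^ N / fact N"
    using assms by (intro real_norm_def[THEN trans] abs_of_nonneg) auto
  also have "\<dots> \<le> pochhammer (norm a) N * s ^ N / fact N"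
    using assms by (intro divide_right_mono mult_right_mono norm_pochhammer_le) auto
  finally show "norm (norm (pochhammer a N) * s ^ N / fact N) \<le> pochhammer (norm a) N * s ^ N / fact N" .
qed

lemma vsum_add: "vsum (a + b) = vsum a + vsum b"
  by (simp add: vsum_def sum.distrib)

lemma pochhammer_nonneg': "0 \<le> (a :: real) \<Longrightarrow> 0 \<le> pochhammer a N"
  by (induction N) (auto simp: pochhammer_rec')

lemma norm_vsum_less: "(\<Sum>r\<in>UNIV. norm ((z :: complex ^ 'k) $ r)) < 1 \<Longrightarrow> norm (vsum z) < 1"
  using norm_sum[of "vec_nth z" UNIV] by (simp add: vsum_def)

lemma vector_binomial_series:
  fixes z :: "complex ^ 'k"
  assumes z: "(\<Sum>r\<in>UNIV. norm (z $ r)) < 1"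
  shows "((\<lambda>p. pochhammer a (vsum p) * divided_power z p) has_sum (1 - vsum z) powr (- a)) UNIV"
proof (rule degree_series)
  show "summable (\<lambda>N. norm (pochhammer a N) * (\<Sum>r\<in>UNIV. norm (z $ r)) ^ N / fact N)"
    using z by (intro summable_norm_pochhammer sum_nonneg) auto
  show "(\<lambda>N. pochhammer a N * vsum z ^ N / fact N) sums (1 - vsum z) powr - a"
    by (rule binomial_series_pochhammer[OF norm_vsum_less[OF z]])
qed

text \<open>
  The same series with absolute values, as a majorant in the proof of absolute convergence of the double series
  for the generating function.
\<close>

lemma vector_binomial_majorant:
  fixes a :: real and z :: "complex ^ 'k"
  assumes z: "(\<Sum>r\<in>UNIV. norm (z $ r)) < 1"
  shows "((\<lambda>p. pochhammer a (vsum p) * divided_power (\<chi> r. norm (z $ r)) p)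
     has_sum (1 - (\<Sum>r\<in>UNIV. norm (z $ r))) powr (- a)) UNIV"
proof -
  let ?S = "\<Sum>r\<in>UNIV. norm (z $ r)"
  have S: "\<bar>?S\<bar> < 1" using z by (simp add: sum_nonneg)
  show ?thesis
  proof (rule degree_series)
    show "summable (\<lambda>N. norm (pochhammer a N) * (\<Sum>r\<in>UNIV. norm ((\<chi> r. norm (z $ r)) $ r)) ^ N / fact N)"
      using z by (intro summable_norm_pochhammer sum_nonneg) auto
    show "(\<lambda>N. pochhammer a N * vsum (\<chi> r. norm (z $ r)) ^ N / fact N) sums (1 - ?S) powr - a"
      using binomial_series_pochhammer_real[OF S] by (simp add: vsum_def)
  qed
qed

lemma degree_exp_series:
  fixes w :: "'a::{real_normed_field, banach} ^ 'k"
  shows "((\<lambda>p. c ^ vsum p * divided_power w p) has_sum exp (c * vsum w)) UNIV"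
proof (rule degree_series)
  have "summable (\<lambda>N. inverse (fact N) * (norm c * (\<Sum>r\<in>UNIV. norm (w $ r))) ^ N)"
    by (rule summable_exp)
  then show "summable (\<lambda>N. norm (c ^ N) * (\<Sum>r\<in>UNIV. norm (w $ r)) ^ N / fact N)"
    by (simp add: norm_power power_mult_distrib divide_inverse mult_ac)
  show "(\<lambda>N. c ^ N * vsum w ^ N / fact N) sums exp (c * vsum w)"
    using exp_converges[of "c * vsum w"]
    by (simp add: power_mult_distrib scaleR_conv_of_real divide_inverse mult_ac)
qed

lemma power_series_zero:
  fixes s :: "nat \<Rightarrow> complex"
  assumes "d > 0" and sums: "\<And>w. norm w < d \<Longrightarrow> (\<lambda>i. s i * w ^ i) sums 0"
  shows "s n = 0"
proof (induction n rule: less_induct)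
  case (less n)
  have "(\<lambda>i. s (i + n) * w ^ i) sums 0" if w: "w \<noteq> 0" "norm w < d" for w
  proof -
    have "(\<lambda>i. s (i + n) * w ^ (i + n)) sums (0 - (\<Sum>i<n. s i * w ^ i))"
      using sums[OF w(2)] by (rule sums_split_initial_segment)
    then have "(\<lambda>i. s (i + n) * w ^ (i + n) * inverse (w ^ n)) sums (0 * inverse (w ^ n))"
      using less by (intro sums_mult2) simp
    then show ?thesis using w by (simp add: power_add mult.assoc)
  qed
  then have "((\<lambda>_. 0) \<longlongrightarrow> s (0 + n)) (at (0 :: complex))"
    by (intro powser_limit_0_strong[OF \<open>d > 0\<close>])
  then show "s n = 0" by (simp add: tendsto_const_iff)
qed

text \<open>
  The coefficients are fixed one variable after the other. Let the sum over the indices that agree with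
  \<open>j0\<close> on a set \<open>A\<close> of variables, with these variables removed from the monomials, be zero near the origin; as a
  function of a further variable it is a power series, so each of its coefficients is zero, and this is the
  claim for the enlarged set. When all variables have been used, a single coefficient is left.
\<close>

lemma multi_power_series_zero:
  fixes D :: "nat ^ 'k \<Rightarrow> complex"
  assumes D: "\<And>z :: complex ^ 'k. (\<Sum>r\<in>UNIV. norm (z $ r)) < 1 \<Longrightarrow> ((\<lambda>j. D j * vpow z j) has_sum 0) UNIV"
  shows "D j0 = 0"
proof -
  \<comment> \<open>The polydisc of this radius lies in the domain of the hypothesis. Unlike that domain it is a product, so the variables can be varied independently.\<close>
  define d where "d = 1 / real CARD('k)"
  have d: "d > 0" by (simp add: d_def)
  have partial: "((\<lambda>j. D j * (\<Prod>r\<in>-A. z $ r ^ j $ r)) has_sum 0) {j. \<forall>r\<in>A. j $ r = j0 $ r}"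
    if "finite A" "\<And>r. norm (z $ r) < d" for A :: "'k set" and z :: "complex ^ 'k"
    using that
  proof (induction A arbitrary: z rule: finite_induct)
    case empty
    have "(\<Sum>r\<in>UNIV. norm (z $ r)) < of_nat CARD('k) * d"
      using empty by (intro sum_bounded_above_strict) auto
    then show ?case using D[of z] by (simp add: d_def vpow_def)
  next
    case (insert q A)
    let ?X = "{j. \<forall>r\<in>A. j $ r = j0 $ r}"
    let ?Y = "\<lambda>i. {j \<in> ?X. j $ q = i}"
    define g where "g j = D j * (\<Prod>r\<in>-insert q A. z $ r ^ j $ r)" for j
    have g_X: "((\<lambda>j. g j * w ^ j $ q) has_sum 0) ?X" if w: "norm w < d" for w
    proof -
      have split: "-A = insert q (- insert q A)" using insert.hyps by auto
      have "(\<Prod>r\<in>-A. (\<chi> r. if r = q then w else z $ r) $ r ^ j $ r)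
          = w ^ j $ q * (\<Prod>r\<in>-insert q A. z $ r ^ j $ r)" for j
      proof -
        have "(\<Prod>r\<in>-A. (\<chi> r. if r = q then w else z $ r) $ r ^ j $ r)
            = w ^ j $ q * (\<Prod>r\<in>-insert q A. (\<chi> r. if r = q then w else z $ r) $ r ^ j $ r)"
          by (subst split, subst prod.insert) auto
        also have "(\<Prod>r\<in>-insert q A. (\<chi> r. if r = q then w else z $ r) $ r ^ j $ r)
            = (\<Prod>r\<in>-insert q A. z $ r ^ j $ r)"
          by (rule prod.cong) auto
        finally show ?thesis .
      qed
      then have "D j * (\<Prod>r\<in>-A. (\<chi> r. if r = q then w else z $ r) $ r ^ j $ r) = g j * w ^ j $ q" for j
        by (simp only: g_def mult_ac)
      then show ?thesis
        using insert.IH[of "\<chi> r. if r = q then w else z $ r"] w insert.prems by simp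
    qed
    have g_Y: "g summable_on ?Y i" for i
    proof -
      let ?w = "of_real (d / 2) :: complex"
      have "norm ?w < d" "?w \<noteq> 0" using d by (simp_all del: of_real_divide)
      from g_X[OF this(1)] have "(\<lambda>j. g j * ?w ^ j $ q) summable_on ?Y i"
        by (rule summable_on_subset_banach[OF has_sum_imp_summable]) auto
      then have "(\<lambda>j. g j * ?w ^ i) summable_on ?Y i"
        by (rule summable_on_cong[THEN iffD1, rotated]) auto
      then have "(\<lambda>j. g j * ?w ^ i * inverse (?w ^ i)) summable_on ?Y i"
        by (rule summable_on_cmult_left)
      then show ?thesis using \<open>?w \<noteq> 0\<close> by (simp add: mult.assoc)
    qed
    define s where "s i = infsum g (?Y i)" for i
    have g_has: "(g has_sum s i) (?Y i)" for i
      unfolding s_def using g_Y by (rule has_sum_infsum)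
    have "(\<lambda>i. s i * w ^ i) sums 0" if w: "norm w < d" for w
    proof (rule has_sum_imp_sums)
      have bij: "bij_betw (\<lambda>j. (j $ q, j)) ?X (Sigma UNIV ?Y)"
        by (rule bij_betw_graph)
      have "((\<lambda>(i, j). g j * w ^ i) has_sum 0) (Sigma UNIV ?Y)"
        using g_X[OF w] has_sum_reindex_bij_betw[OF bij, of "\<lambda>(i, j). g j * w ^ i" 0] by simp
      then show "((\<lambda>i. s i * w ^ i) has_sum 0) UNIV"
        by (rule has_sum_SigmaD) (simp only: split, rule has_sum_cmult_left[OF g_has])
    qed
    then have "s (j0 $ q) = 0" by (rule power_series_zero[OF d])
    moreover have "?Y (j0 $ q) = {j. \<forall>r\<in>insert q A. j $ r = j0 $ r}" by auto
    ultimately have "(g has_sum 0) {j. \<forall>r\<in>insert q A. j $ r = j0 $ r}"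
      using g_has[of "j0 $ q"] by metis
    then show ?case unfolding g_def .
  qed
  have "((\<lambda>j. D j * (\<Prod>r\<in>-UNIV. 0 ^ j $ r)) has_sum 0) {j0}"
  proof -
    have "{j. \<forall>r\<in>UNIV. j $ r = j0 $ r} = {j0}" by (auto simp: vec_eq_iff)
    then show ?thesis using partial[of UNIV 0] d by simp
  qed
  then have "((\<lambda>j. D j) has_sum 0) {j0}" by simp
  then show ?thesis using has_sum_finite[of "{j0}" D] has_sum_unique by fastforce
qed

section \<open>Explicit form of the Laguerre polynomials\<close>

abbreviation multi_le :: "nat ^ 'k \<Rightarrow> (nat ^ 'k) set" where
  "multi_le n \<equiv> {j. \<forall>r. j $ r \<le> n $ r}"

lemma finite_multi_le:
  fixes n :: "nat ^ 'k"
  shows "finite (multi_le n)"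
proof -
  have "finite (vec_lambda ` PiE UNIV (\<lambda>r. {..n $ r}))"
    by (intro finite_imageI finite_PiE) auto
  moreover have "multi_le n \<subseteq> vec_lambda ` PiE UNIV (\<lambda>r. {..n $ r})"
  proof
    fix j :: "nat ^ 'k" assume "j \<in> multi_le n"
    then show "j \<in> vec_lambda ` PiE UNIV (\<lambda>r. {..n $ r})"
      by (intro image_eqI[of _ _ "vec_nth j"]) auto
  qed
  ultimately show ?thesis by (rule finite_subset[rotated])
qed

text \<open>
  This is \<open>1 / (n - j)!\<close> for \<open>j \<le> n\<close>. Writing it with \<open>1/\<Gamma>\<close> makes it vanish for all other \<open>j\<close>, and it is
  in this form that the factor comes out of the integrals over the variables \<open>z\<^sub>r\<close>.
\<close>

definition codegree_factor :: "nat ^ 'k \<Rightarrow> nat ^ 'k \<Rightarrow> complex" where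
  "codegree_factor n j = (\<Prod>r\<in>UNIV. rGamma (of_nat (n $ r) - of_nat (j $ r) + 1))"

lemma rGamma_nat_diff:
  "rGamma (of_nat n - of_nat j + 1 :: complex) = (if j \<le> n then 1 / fact (n - j) else 0)"
proof (cases "j \<le> n")
  case True
  then have eq: "of_nat n - of_nat j + 1 = (1 + of_nat (n - j) :: complex)"
    by (simp add: of_nat_diff)
  show ?thesis
    unfolding eq rGamma_inverse_Gamma Gamma_fact using True by (simp add: divide_inverse)
next
  case False
  then have "of_nat n - of_nat j + 1 = (- of_nat (j - Suc n) :: complex)"
    by (simp add: of_nat_diff algebra_simps)
  then have "of_nat n - of_nat j + 1 \<in> (\<int>\<^sub>\<le>\<^sub>0 :: complex set)" by simp
  then show ?thesis using False by (simp add: rGamma_eq_zero_iff)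
qed

lemma codegree_factor_support: "codegree_factor n j \<noteq> 0 \<Longrightarrow> j $ r \<le> n $ r"
proof (rule ccontr)
  assume nz: "codegree_factor n j \<noteq> 0" and "\<not> j $ r \<le> n $ r"
  then have "rGamma (of_nat (n $ r) - of_nat (j $ r) + 1 :: complex) = 0"
    by (simp add: rGamma_nat_diff)
  then have "codegree_factor n j = 0"
    unfolding codegree_factor_def by (intro prod_zero bexI[of _ r]) auto
  with nz show False ..
qed

definition laguerre_coeff :: "complex \<Rightarrow> nat ^ 'k \<Rightarrow> complex ^ 'k \<Rightarrow> complex" where
  "laguerre_coeff a n x = (\<Sum>j\<in>multi_le n. pochhammer (a + 1 + of_nat (vsum j)) (vsum (n - j)) *
     (divided_power (- x) j * codegree_factor n j))"

text \<open>
  The generating function is the double series of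
  \<open>pochhammer (a + 1 + \<bar>j\<bar>) \<bar>p\<bar> (-x z)\<^sup>j / j! z\<^sup>p / p!\<close> over all multi-indices \<open>j\<close> and \<open>p\<close>. Summing first over
  \<open>p\<close> gives \<open>(1 - vsum z) powr (- a - 1 - \<bar>j\<bar>)\<close> by the binomial series, and then the sum over \<open>j\<close> is an
  exponential series; collecting the terms with \<open>j + p = n\<close> instead gives the coefficients. The rearrangement is
  justified by the majorant \<open>M\<close>, a series of the same shape with \<open>norm (a + 1)\<close> for \<open>a + 1\<close> and with the
  absolute values of the monomials, whose sum is finite by the same computation.
\<close>

lemma laguerre_generating_function:
  fixes x z :: "complex ^ 'k"
  assumes z: "(\<Sum>r\<in>UNIV. norm (z $ r)) < 1"
  shows "((\<lambda>n. laguerre_coeff a n x * vpow z n) has_sum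
     (1 - vsum z) powr (- a - 1) * exp (- (vsum (x * z) / (1 - vsum z)))) UNIV"
proof -
  define w where "w = (\<chi> r. - (x $ r * z $ r))"
  let ?S = "\<Sum>r\<in>UNIV. norm (z $ r)"
  let ?z = "\<chi> r. norm (z $ r)" and ?w = "\<chi> r. norm (w $ r)"
  define T where "T = (\<lambda>(j :: nat ^ 'k, p :: nat ^ 'k).
     divided_power w j * (pochhammer (a + 1 + of_nat (vsum j)) (vsum p) * divided_power z p))"
  define M where "M = (\<lambda>(j :: nat ^ 'k, p :: nat ^ 'k).
     divided_power ?w j * (pochhammer (norm (a + 1) + of_nat (vsum j)) (vsum p) * divided_power ?z p))"
  have nz: "1 - vsum z \<noteq> 0" using norm_vsum_less[OF z] by auto
  have M_nonneg: "0 \<le> M jp" for jp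
    unfolding M_def case_prod_beta
    by (intro mult_nonneg_nonneg divided_power_nonneg pochhammer_nonneg') auto
  have "M summable_on UNIV \<times> UNIV"
  proof (rule summable_on_SigmaI)
    show "((\<lambda>p. M (j, p)) has_sum divided_power ?w j * (1 - ?S) powr (- (norm (a + 1) + of_nat (vsum j)))) UNIV" for j
      unfolding M_def split by (intro has_sum_cmult_right vector_binomial_majorant z)
    have "(\<lambda>j. (1 - ?S) powr (- norm (a + 1)) * ((1 / (1 - ?S)) ^ vsum j * divided_power ?w j)) summable_on UNIV"
      by (intro summable_on_cmult_right has_sum_imp_summable[OF degree_exp_series])
    moreover have "divided_power ?w j * (1 - ?S) powr (- (norm (a + 1) + of_nat (vsum j)))
        = (1 - ?S) powr (- norm (a + 1)) * ((1 / (1 - ?S)) ^ vsum j * divided_power ?w j)" for j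
      using z by (simp add: powr_diff powr_realpow power_inverse divide_inverse)
    ultimately show "(\<lambda>j. divided_power ?w j * (1 - ?S) powr (- (norm (a + 1) + of_nat (vsum j)))) summable_on UNIV"
      by (simp only:)
    show "0 \<le> M (j, p)" for j p by (rule M_nonneg)
  qed
  then have "(\<lambda>jp. norm (M jp)) summable_on UNIV \<times> UNIV"
    using M_nonneg by (simp add: abs_of_nonneg)
  then have "(\<lambda>jp. norm (T jp)) summable_on UNIV \<times> UNIV"
  proof (rule Infinite_Sum.abs_summable_on_comparison_test)
    fix jp :: "(nat ^ 'k) \<times> (nat ^ 'k)"
    obtain j p where jp: "jp = (j, p)" by (cases jp)
    have "norm (a + 1 + of_nat (vsum j)) \<le> norm (a + 1) + of_nat (vsum j)"
      using norm_triangle_ineq[of "a + 1" "of_nat (vsum j)"] by simp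
    from norm_pochhammer_le[OF this, of "vsum p"]
    have "norm (T jp) \<le> M jp"
      unfolding T_def M_def jp split norm_mult norm_divided_power
      by (intro mult_left_mono mult_right_mono divided_power_nonneg) auto
    then show "norm (T jp) \<le> norm (M jp)" by simp
  qed
  then have "T summable_on UNIV \<times> UNIV" by (rule abs_summable_summable)
  moreover have "((\<lambda>p. T (j, p)) has_sum
      (1 - vsum z) powr (- a - 1) * ((1 / (1 - vsum z)) ^ vsum j * divided_power w j)) UNIV" for j
  proof -
    have "((\<lambda>p. T (j, p)) has_sum divided_power w j * (1 - vsum z) powr (- (a + 1 + of_nat (vsum j)))) UNIV"
      unfolding T_def split by (intro has_sum_cmult_right vector_binomial_series z)
    moreover have "(1 - vsum z) powr (- (a + 1 + of_nat (vsum j)))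
        = (1 - vsum z) powr (- a - 1) * (1 / (1 - vsum z)) ^ vsum j"
    proof -
      have "- (a + 1 + of_nat (vsum j)) = (- a - 1) - of_nat (vsum j)" by simp
      then show ?thesis
        using nz by (simp only: powr_diff powr_nat power_one_over if_False) simp
    qed
    ultimately show ?thesis by (simp add: mult_ac)
  qed
  moreover have "((\<lambda>j. (1 - vsum z) powr (- a - 1) * ((1 / (1 - vsum z)) ^ vsum j * divided_power w j)) has_sum
      (1 - vsum z) powr (- a - 1) * exp (- (vsum (x * z) / (1 - vsum z)))) UNIV"
  proof -
    have "1 / (1 - vsum z) * vsum w = - (vsum (x * z) / (1 - vsum z))"
      by (simp add: w_def vsum_def sum_negf)
    then show ?thesis
      using has_sum_cmult_right[OF degree_exp_series[of "1 / (1 - vsum z)" w]] by metis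
  qed
  ultimately have T: "(T has_sum (1 - vsum z) powr (- a - 1) * exp (- (vsum (x * z) / (1 - vsum z)))) (UNIV \<times> UNIV)"
    by (intro has_sum_SigmaI)
  have bij: "bij_betw (\<lambda>(n, j). (j, n - j)) (Sigma UNIV (\<lambda>n :: nat ^ 'k. multi_le n)) (UNIV \<times> UNIV)"
    by (rule bij_betw_byWitness[where f' = "\<lambda>(j, p). (j + p, j)"]) (auto simp: vec_eq_iff)
  have "((\<lambda>(n, j). T (j, n - j)) has_sum (1 - vsum z) powr (- a - 1) * exp (- (vsum (x * z) / (1 - vsum z))))
      (Sigma UNIV (\<lambda>n :: nat ^ 'k. multi_le n))"
    using T has_sum_reindex_bij_betw[OF bij, of T] by (simp add: case_prod_unfold)
  then show ?thesis
  proof (rule has_sum_SigmaD)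
    fix n :: "nat ^ 'k"
    have "T (j, n - j) = pochhammer (a + 1 + of_nat (vsum j)) (vsum (n - j)) *
        (divided_power (- x) j * codegree_factor n j) * vpow z n"
      if j: "\<forall>r. j $ r \<le> n $ r" for j
    proof -
      have "divided_power w j * divided_power z (n - j)
          = divided_power (- x) j * codegree_factor n j * vpow z n"
        unfolding divided_power_def vpow_def codegree_factor_def prod.distrib [symmetric]
      proof (intro prod.cong refl)
        fix r
        have "z $ r ^ n $ r = z $ r ^ j $ r * z $ r ^ (n $ r - j $ r)"
          using j by (simp add: power_add [symmetric])
        moreover have "w $ r ^ j $ r = (- (x $ r)) ^ j $ r * z $ r ^ j $ r"
          by (simp add: w_def power_mult_distrib [symmetric])
        moreover have "rGamma (of_nat (n $ r) - of_nat (j $ r) + 1) = (1 / fact (n $ r - j $ r) :: complex)"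
          using j by (simp add: rGamma_nat_diff)
        ultimately show "w $ r ^ j $ r / fact (j $ r) * (z $ r ^ (n - j) $ r / fact ((n - j) $ r))
            = (- x) $ r ^ j $ r / fact (j $ r) * rGamma (of_nat (n $ r) - of_nat (j $ r) + 1) * z $ r ^ n $ r"
          by (simp add: mult_ac)
      qed
      then show ?thesis unfolding T_def split by (simp add: mult_ac)
    qed
    then show "((\<lambda>j. case (n, j) of (n, j) \<Rightarrow> T (j, n - j)) has_sum laguerre_coeff a n x * vpow z n) (multi_le n)"
      by (intro has_sum_finiteI finite_multi_le) (simp add: laguerre_coeff_def sum_distrib_right)
  qed
qed

lemma Laguerre_eq:
  fixes n :: "nat ^ 'k"
  shows "Laguerre a n x = laguerre_coeff a n x"
proof -
  let ?P = "\<lambda>L :: nat ^ 'k \<Rightarrow> complex. \<forall>z :: complex ^ 'k. (\<Sum>r\<in>UNIV. norm (z $ r)) < 1 \<longrightarrow>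
          ((\<lambda>j. L j * vpow z j) has_sum
             ((1 - vsum z) powr (- a - 1) * exp (- (vsum (x * z) / (1 - vsum z))))) UNIV"
  have P: "?P (\<lambda>n. laguerre_coeff a n x)"
    using laguerre_generating_function by blast
  have "L = (\<lambda>n. laguerre_coeff a n x)" if L: "?P L" for L
  proof
    fix j
    have "L j - laguerre_coeff a j x = 0"
    proof (rule multi_power_series_zero)
      fix z :: "complex ^ 'k" assume z: "(\<Sum>r\<in>UNIV. norm (z $ r)) < 1"
      show "((\<lambda>j. (L j - laguerre_coeff a j x) * vpow z j) has_sum 0) UNIV"
        using has_sum_add[OF L[rule_format, OF z] has_sum_cmult_right[OF P[rule_format, OF z], of "- 1"]]
        by (simp add: left_diff_distrib)
    qed
    then show "L j = laguerre_coeff a j x" by simp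
  qed
  then have "(THE L. ?P L) = (\<lambda>n. laguerre_coeff a n x)"
    using P by (intro the_equality)
  then show ?thesis unfolding Laguerre_def by simp
qed

text \<open>
  Since \<open>1/\<Gamma>(w) = pochhammer w N / \<Gamma>(w + N)\<close> for every \<open>w\<close>, the normalisation by \<open>1/\<Gamma>\<close> turns the
  Pochhammer symbols into reciprocal Gamma values that depend on \<open>a\<close> and \<open>vsum j\<close> only.
\<close>

lemma Laguerre_rGamma:
  fixes n :: "nat ^ 'k"
  shows "Laguerre a n x * rGamma (a + 1 + of_nat (vsum n))
     = (\<Sum>j\<in>multi_le n. rGamma (a + 1 + of_nat (vsum j)) * divided_power (- x) j * codegree_factor n j)"
  unfolding Laguerre_eq laguerre_coeff_def sum_distrib_right
proof (intro sum.cong refl)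
  fix j assume "j \<in> multi_le n"
  then have "j + (n - j) = n" by (simp add: vec_eq_iff)
  then have "vsum n = vsum j + vsum (n - j)" by (metis vsum_add)
  then have "rGamma (a + 1 + of_nat (vsum j)) =
      pochhammer (a + 1 + of_nat (vsum j)) (vsum (n - j)) * rGamma (a + 1 + of_nat (vsum n))"
    by (subst pochhammer_rGamma[of _ "vsum (n - j)"]) (simp add: add.assoc)
  then show "pochhammer (a + 1 + of_nat (vsum j)) (vsum (n - j)) *
       (divided_power (- x) j * codegree_factor n j) * rGamma (a + 1 + of_nat (vsum n)) =
     rGamma (a + 1 + of_nat (vsum j)) * divided_power (- x) j * codegree_factor n j"
    by simp
qed

section \<open>Integrals over the torus\<close>

lemma Basis_real_vec: "(Basis :: (real ^ 'k) set) = range (\<lambda>r. axis r 1)"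
  by (auto simp: Basis_vec_def)

lemma inj_axis_one: "inj (\<lambda>r :: 'k::finite. axis r (1 :: real))"
  by (auto simp: inj_on_def axis_eq_axis)

text \<open>
  Lebesgue measure on vectors is the image of a product measure indexed by the standard basis; the proof
  translates between basis vectors and indices.
\<close>

lemma lborel_vec_integral_prod:
  fixes f :: "'k::finite \<Rightarrow> real \<Rightarrow> complex"
  assumes f: "\<And>r. integrable lborel (f r)"
  shows "integrable lborel (\<lambda>t :: real ^ 'k. \<Prod>r\<in>UNIV. f r (t $ r))"
    and "(LINT t|lborel. (\<Prod>r\<in>UNIV. f r ((t :: real ^ 'k) $ r))) = (\<Prod>r\<in>UNIV. integral\<^sup>L lborel (f r))"
proof -
  interpret product_sigma_finite "\<lambda>_ :: real ^ 'k. lborel :: real measure"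
    by standard
  let ?e = "\<lambda>r :: 'k. axis r (1 :: real)"
  define F where "F b = f (the_inv ?e b)" for b
  have F: "F (?e r) = f r" for r
    by (simp add: F_def the_inv_f_f[OF inj_axis_one])
  let ?T = "\<lambda>g :: real ^ 'k \<Rightarrow> real. \<Sum>b\<in>Basis. g b *\<^sub>R b"
  have T: "?T g $ r = g (?e r)" for g r
  proof -
    have axis: "?e k $ r = (if k = r then 1 else 0)" for k by (auto simp: axis_def)
    have "(\<Sum>k\<in>UNIV. g (?e k) * ?e k $ r) = g (?e r)"
      by (simp add: axis if_distrib cong: if_cong)
    then show ?thesis
      unfolding Basis_real_vec by (subst sum.reindex[OF inj_axis_one]) simp
  qed
  have prod: "(\<Prod>r\<in>UNIV. f r (?T g $ r)) = (\<Prod>b\<in>Basis. F b (g b))" for g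
  proof -
    have "(\<Prod>b\<in>Basis. F b (g b)) = (\<Prod>r\<in>UNIV. f r (g (?e r)))"
      unfolding Basis_real_vec by (subst prod.reindex[OF inj_axis_one]) (simp add: F)
    then show ?thesis by (simp only: T)
  qed
  have int: "integrable (\<Pi>\<^sub>M b\<in>Basis. lborel) (\<lambda>g. \<Prod>b\<in>Basis. F b (g b))"
    by (rule product_integrable_prod) (auto simp: Basis_real_vec F f)
  have meas: "(\<lambda>t :: real ^ 'k. \<Prod>r\<in>UNIV. f r (t $ r)) \<in> borel_measurable borel"
  proof (rule borel_measurable_prod)
    fix r
    have "f r \<in> borel_measurable borel" using f[of r] by (simp add: integrable_iff_bounded)
    then show "(\<lambda>t :: real ^ 'k. f r (t $ r)) \<in> borel_measurable borel"
      by (rule measurable_compose[rotated]) simp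
  qed
  have Tm: "?T \<in> measurable (\<Pi>\<^sub>M b\<in>Basis. lborel) borel"
    by (rule borel_measurable_sum) simp
  show "integrable lborel (\<lambda>t :: real ^ 'k. \<Prod>r\<in>UNIV. f r (t $ r))"
    unfolding lborel_eq[where 'a = "real ^ 'k"]
    by (subst integrable_distr_eq[OF Tm meas]) (simp only: prod int)
  have "(LINT t|lborel. (\<Prod>r\<in>UNIV. f r ((t :: real ^ 'k) $ r)))
      = (LINT g|(\<Pi>\<^sub>M b\<in>Basis. lborel). (\<Prod>b\<in>Basis. F b (g b)))"
    unfolding lborel_eq[where 'a = "real ^ 'k"]
    by (subst integral_distr[OF Tm meas]) (simp only: prod)
  also have "\<dots> = (\<Prod>b\<in>Basis. integral\<^sup>L lborel (F b))"
    by (rule product_integral_prod) (auto simp: Basis_real_vec F f)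
  also have "\<dots> = (\<Prod>r\<in>UNIV. integral\<^sup>L lborel (f r))"
    unfolding Basis_real_vec by (subst prod.reindex[OF inj_axis_one]) (simp add: F)
  finally show "(LINT t|lborel. (\<Prod>r\<in>UNIV. f r ((t :: real ^ 'k) $ r))) = (\<Prod>r\<in>UNIV. integral\<^sup>L lborel (f r))" .
qed

lemma lborel_integral_times:
  fixes f :: "real \<Rightarrow> complex" and g :: "'b::euclidean_space \<Rightarrow> complex"
  assumes f: "integrable lborel f" and g: "integrable lborel g"
  shows "integrable lborel (\<lambda>(s, t). f s * g t)"
    and "(LINT p|lborel. (case p of (s, t) \<Rightarrow> f s * g t)) = integral\<^sup>L lborel f * integral\<^sup>L lborel g"
proof -
  have [measurable]: "f \<in> borel_measurable borel" "g \<in> borel_measurable borel"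
    using f g by (simp_all add: integrable_iff_bounded)
  have int: "integrable (lborel \<Otimes>\<^sub>M lborel) (\<lambda>(s, t). f s * g t)"
  proof (rule lborel_pair.Fubini_integrable)
    have "integrable lborel (\<lambda>s. norm (f s) * (LINT t|lborel. norm (g t)))"
      using f by (intro integrable_mult_left integrable_norm) auto
    then show "integrable lborel (\<lambda>s. LINT t|lborel. norm (case (s, t) of (s, t) \<Rightarrow> f s * g t))"
      by (simp add: norm_mult)
    show "AE s in lborel. integrable lborel (\<lambda>t. case (s, t) of (s, t) \<Rightarrow> f s * g t)"
      using g by auto
  qed measurable
  then show "integrable lborel (\<lambda>(s, t). f s * g t)"
    by (simp only: lborel_prod)
  show "(LINT p|lborel. (case p of (s, t) \<Rightarrow> f s * g t)) = integral\<^sup>L lborel f * integral\<^sup>L lborel g"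
    using lborel_pair.integral_fst'[OF int] by (simp add: lborel_prod)
qed

lemma torus_integral_product:
  fixes g :: "'k::finite \<Rightarrow> complex \<Rightarrow> complex"
  assumes f: "set_integrable lborel {- pi..pi} (\<lambda>s. f (cis s) * (\<i> * cis s))"
    and g: "\<And>r. set_integrable lborel {- pi..pi} (\<lambda>s. g r (cis s) * (\<i> * cis s))"
  shows "torus_integrable (\<lambda>u z. f u * (\<Prod>r\<in>UNIV. g r (z $ r)))"
    and "torus_integral (\<lambda>u z. f u * (\<Prod>r\<in>UNIV. g r (z $ r)))
      = (LINT s:{- pi..pi}|lborel. f (cis s) * (\<i> * cis s))
        * (\<Prod>r\<in>UNIV. LINT s:{- pi..pi}|lborel. g r (cis s) * (\<i> * cis s))"
proof -
  define \<phi> where "\<phi> s = indicator {- pi..pi} s *\<^sub>R (f (cis s) * (\<i> * cis s))" for s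
  define \<gamma> where "\<gamma> r s = indicator {- pi..pi} s *\<^sub>R (g r (cis s) * (\<i> * cis s))" for r s
  have \<phi>: "integrable lborel \<phi>" using f unfolding set_integrable_def \<phi>_def .
  have \<gamma>: "integrable lborel (\<gamma> r)" for r using g[of r] unfolding set_integrable_def \<gamma>_def .
  have eq: "(\<lambda>p. indicator torus_box p *\<^sub>R torus_pullback (\<lambda>u z. f u * (\<Prod>r\<in>UNIV. g r (z $ r))) p)
      = (\<lambda>(s, t :: real ^ 'k). \<phi> s * (\<Prod>r\<in>UNIV. \<gamma> r (t $ r)))"
  proof (rule ext, clarify)
    fix s and t :: "real ^ 'k"
    show "indicator torus_box (s, t) *\<^sub>R torus_pullback (\<lambda>u z. f u * (\<Prod>r\<in>UNIV. g r (z $ r))) (s, t)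
      = \<phi> s * (\<Prod>r\<in>UNIV. \<gamma> r (t $ r))"
    proof (cases "(s, t) \<in> torus_box")
      case True
      then show ?thesis
        by (simp add: torus_box_def torus_pullback_def \<phi>_def \<gamma>_def prod.distrib mult_ac)
    next
      case False
      then have "\<phi> s = 0 \<or> (\<exists>r. \<gamma> r (t $ r) = 0)"
        by (auto simp: torus_box_def \<phi>_def \<gamma>_def indicator_def)
      then have "\<phi> s * (\<Prod>r\<in>UNIV. \<gamma> r (t $ r)) = 0" by auto
      with False show ?thesis by simp
    qed
  qed
  show "torus_integrable (\<lambda>u z. f u * (\<Prod>r\<in>UNIV. g r (z $ r)))"
    unfolding torus_integrable_def set_integrable_def eq
    by (rule lborel_integral_times(1)[OF \<phi> lborel_vec_integral_prod(1)[OF \<gamma>]])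
  show "torus_integral (\<lambda>u z. f u * (\<Prod>r\<in>UNIV. g r (z $ r)))
      = (LINT s:{- pi..pi}|lborel. f (cis s) * (\<i> * cis s))
        * (\<Prod>r\<in>UNIV. LINT s:{- pi..pi}|lborel. g r (cis s) * (\<i> * cis s))"
    unfolding torus_integral_def set_lebesgue_integral_def eq \<phi>_def [symmetric] \<gamma>_def [symmetric]
    using lborel_integral_times(2)[OF \<phi> lborel_vec_integral_prod(1)[of \<gamma>, OF \<gamma>]]
    unfolding lborel_vec_integral_prod(2)[of \<gamma>, OF \<gamma>] .
qed

lemma torus_integral_sum:
  assumes "\<And>k. k \<in> S \<Longrightarrow> torus_integrable (G k)"
    and eq: "\<And>u z. norm u = 1 \<Longrightarrow> (\<And>r. norm (z $ r) = 1) \<Longrightarrow> F u z = (\<Sum>k\<in>S. c k * G k u z)"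
  shows "torus_integrable F" and "torus_integral F = (\<Sum>k\<in>S. c k * torus_integral (G k))"
proof -
  have "torus_pullback F p = (\<Sum>k\<in>S. c k * torus_pullback (G k) p)" for p
    by (cases p) (simp add: torus_pullback_def eq sum_distrib_left sum_distrib_right mult_ac)
  then have pull: "torus_pullback F = (\<lambda>p. \<Sum>k\<in>S. c k * torus_pullback (G k) p)" by auto
  have int: "set_integrable lborel torus_box (\<lambda>p. c k * torus_pullback (G k) p)" if "k \<in> S" for k
    using assms(1)[OF that] unfolding torus_integrable_def by (rule set_integrable_mult_right)
  show "torus_integrable F"
    unfolding torus_integrable_def pull using int
    unfolding set_integrable_def scaleR_sum_right by (intro Bochner_Integration.integrable_sum)
  have "torus_integral F = (\<Sum>k\<in>S. LINT p:torus_box|lborel. c k * torus_pullback (G k) p)"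
    unfolding torus_integral_def pull using int
    unfolding set_integrable_def set_lebesgue_integral_def scaleR_sum_right
    by (intro Bochner_Integration.integral_sum)
  then show "torus_integral F = (\<Sum>k\<in>S. c k * torus_integral (G k))"
    by (simp add: torus_integral_def)
qed

section \<open>The product formula\<close>

lemma divided_power_add:
  fixes v w :: "'a::real_normed_field ^ 'k"
  shows "divided_power (v + w) j = (\<Sum>a\<in>multi_le j. divided_power v a * divided_power w (j - a))"
proof -
  have "(v $ r + w $ r) ^ j $ r / fact (j $ r)
      = (\<Sum>a\<le>j $ r. v $ r ^ a / fact a * (w $ r ^ (j $ r - a) / fact (j $ r - a)))" for r
    unfolding binomial_ring sum_divide_distrib by (intro sum.cong) (auto simp: binomial_fact)
  then have "divided_power (v + w) j
      = (\<Prod>r\<in>UNIV. \<Sum>a\<le>j $ r. v $ r ^ a / fact a * (w $ r ^ (j $ r - a) / fact (j $ r - a)))"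
    by (simp add: divided_power_def)
  also have "\<dots> = (\<Sum>g\<in>PiE UNIV (\<lambda>r. {..j $ r}).
      \<Prod>r\<in>UNIV. v $ r ^ g r / fact (g r) * (w $ r ^ (j $ r - g r) / fact (j $ r - g r)))"
    by (rule prod_sum_PiE) auto
  also have "\<dots> = (\<Sum>a\<in>multi_le j. divided_power v a * divided_power w (j - a))"
    by (rule sum.reindex_bij_witness[of _ vec_nth vec_lambda])
       (auto simp: divided_power_def PiE_def simp flip: prod.distrib)
  finally show ?thesis .
qed

lemma omega_shift:
  assumes "norm u = 1"
  shows "omega A B u * ((1 + u) ^ (a + b) / u ^ a) = omega (A + of_nat a) (B + of_nat b) u"
proof (cases "u = - 1")
  case False
  have u: "u \<noteq> 0" using assms by auto
  have nz: "1 + u \<noteq> 0" using False by (metis add.commute eq_neg_iff_add_eq_0)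
  have e: "1 + 1 / u = (1 + u) / u" using u by (simp add: add_divide_distrib)
  have nz': "1 + 1 / u \<noteq> 0" unfolding e using u nz by simp
  have "omega (A + of_nat a) (B + of_nat b) u
      = omega A B u * ((1 + 1 / u) ^ a * (1 + u) ^ b)"
    using nz nz' by (simp add: omega_def powr_add powr_nat)
  also have "(1 + 1 / u) ^ a * (1 + u) ^ b = (1 + u) ^ (a + b) / u ^ a"
    unfolding e by (simp add: power_divide power_add)
  finally show ?thesis ..
qed simp

lemma omega_nat_shift:
  assumes "norm z = 1"
  shows "omega (of_nat m) (of_nat n) z * (z ^ a / (1 + z) ^ (a + b))
     = omega (of_nat m - of_nat a) (of_nat n - of_nat b) z"
proof (cases "z = - 1")
  case False
  have "1 + z \<noteq> 0" using False by (metis add.commute eq_neg_iff_add_eq_0)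
  moreover have "z \<noteq> 0" using assms by auto
  ultimately have inv: "(1 + z) ^ (a + b) / z ^ a * (z ^ a / (1 + z) ^ (a + b)) = 1" by simp
  have "omega (of_nat m) (of_nat n) z
      = omega (of_nat m - of_nat a) (of_nat n - of_nat b) z * ((1 + z) ^ (a + b) / z ^ a)"
    using omega_shift[OF assms, of "of_nat m - of_nat a" "of_nat n - of_nat b" a b] by simp
  then show ?thesis by (simp only: mult.assoc inv mult_1_right)
qed simp

text \<open>
  The points \<open>xi_tilde\<close> and \<open>eta_tilde\<close> depend on \<open>x\<close> and \<open>y\<close> through factors that are powers of
  \<open>1 + u\<close>, \<open>u\<close>, \<open>1 + z\<^sub>r\<close> and \<open>z\<^sub>r\<close>, and these are absorbed by the weights.
\<close>

lemma integrand_monomial: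
  fixes z :: "complex ^ 'k"
  assumes u: "norm u = 1" and z: "\<And>r. norm (z $ r) = 1"
  shows "omega \<alpha> \<beta> u * (\<Prod>r\<in>UNIV. omega (of_nat (m $ r)) (of_nat (n $ r)) (z $ r)) *
     (divided_power (- xi_tilde x u z) a * divided_power (- eta_tilde y u z) b)
   = divided_power (- x) a * divided_power (- y) b *
     (omega (\<alpha> + of_nat (vsum a)) (\<beta> + of_nat (vsum b)) u *
     (\<Prod>r\<in>UNIV. omega (of_nat (m $ r) - of_nat (a $ r)) (of_nat (n $ r) - of_nat (b $ r)) (z $ r)))"
proof -
  have xi_r: "(- xi_tilde x u z) $ r = (1 + u) / (1 + z $ r) * (z $ r / u) * (- x) $ r"
    and eta_r: "(- eta_tilde y u z) $ r = (1 + u) / (1 + z $ r) * (- y) $ r" for r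
    by (simp_all add: xi_tilde_def eta_tilde_def)
  have xi: "divided_power (- xi_tilde x u z) a
      = divided_power (- x) a * ((1 + u) ^ vsum a / u ^ vsum a) * (\<Prod>r\<in>UNIV. z $ r ^ a $ r / (1 + z $ r) ^ a $ r)"
    unfolding divided_power_def vsum_def power_sum prod_dividef [symmetric] prod.distrib [symmetric]
    by (intro prod.cong refl) (simp only: xi_r power_mult_distrib power_divide times_divide_eq_left times_divide_eq_right divide_divide_eq_left mult_1_left mult_1_right mult_ac)
  have eta: "divided_power (- eta_tilde y u z) b
      = divided_power (- y) b * (1 + u) ^ vsum b * (\<Prod>r\<in>UNIV. 1 / (1 + z $ r) ^ b $ r)"
    unfolding divided_power_def vsum_def power_sum prod.distrib [symmetric]
    by (intro prod.cong refl) (simp only: eta_r power_mult_distrib power_divide times_divide_eq_left times_divide_eq_right divide_divide_eq_left mult_1_left mult_1_right mult_ac)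
  have "(\<Prod>r\<in>UNIV. omega (of_nat (m $ r) - of_nat (a $ r)) (of_nat (n $ r) - of_nat (b $ r)) (z $ r))
     = (\<Prod>r\<in>UNIV. omega (of_nat (m $ r)) (of_nat (n $ r)) (z $ r)) *
       ((\<Prod>r\<in>UNIV. z $ r ^ a $ r / (1 + z $ r) ^ a $ r) * (\<Prod>r\<in>UNIV. 1 / (1 + z $ r) ^ b $ r))"
    unfolding prod.distrib [symmetric] omega_nat_shift[OF z, symmetric]
    by (intro prod.cong refl) (simp add: power_add)
  moreover have "omega (\<alpha> + of_nat (vsum a)) (\<beta> + of_nat (vsum b)) u
     = omega \<alpha> \<beta> u * ((1 + u) ^ vsum a / u ^ vsum a * (1 + u) ^ vsum b)"
    unfolding omega_shift[OF u, symmetric] by (simp add: power_add)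
  ultimately show ?thesis
    unfolding xi eta by (simp only: mult_ac)
qed

text \<open>
  The variable \<open>u\<close> and the variables \<open>z\<^sub>r\<close> contribute the same kind of integral. The Gamma values in the
  numerators cancel against the normalising factors of the term of index \<open>a + b\<close> in the Laguerre polynomial of
  degree \<open>m + n\<close>: their arguments have positive real part, for \<open>u\<close> by the assumption on \<open>\<alpha> + \<beta>\<close> and for \<open>z\<^sub>r\<close>
  because \<open>a + b \<le> m + n\<close>.
\<close>

lemma torus_integral_monomial:
  fixes m n a b :: "nat ^ 'k"
  assumes ab: "Re (\<alpha> + \<beta>) > -1" and le: "a + b \<in> multi_le (m + n)"
  defines "G \<equiv> \<lambda>u (z :: complex ^ 'k). omega (\<alpha> + of_nat (vsum a)) (\<beta> + of_nat (vsum b)) u *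
     (\<Prod>r\<in>UNIV. omega (of_nat (m $ r) - of_nat (a $ r)) (of_nat (n $ r) - of_nat (b $ r)) (z $ r))"
  shows "torus_integrable G"
    and "rGamma (\<alpha> + \<beta> + 1 + of_nat (vsum (a + b))) * codegree_factor (m + n) (a + b) * torus_integral G
      = (2 * of_real pi * \<i>) ^ (CARD('k) + 1) *
        ((rGamma (\<alpha> + 1 + of_nat (vsum a)) * codegree_factor m a) *
         (rGamma (\<beta> + 1 + of_nat (vsum b)) * codegree_factor n b))"
proof -
  let ?\<alpha> = "\<alpha> + of_nat (vsum a)" and ?\<beta> = "\<beta> + of_nat (vsum b)"
  let ?m = "\<lambda>r. of_nat (m $ r) - of_nat (a $ r) :: complex" and ?n = "\<lambda>r. of_nat (n $ r) - of_nat (b $ r) :: complex"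
  have le': "a $ r + b $ r \<le> m $ r + n $ r" for r using le by simp
  have Re1: "Re (?\<alpha> + ?\<beta>) > -1" using ab by simp
  have Re2: "Re (?m r + ?n r) > -1" for r
    using of_nat_mono[OF le'[of r], where 'a = real] by simp
  have Gamma_rGamma: "Gamma w * rGamma w = 1" if "Re w > 0" for w :: complex
  proof -
    have "w \<notin> \<int>\<^sub>\<le>\<^sub>0" using that by (auto elim!: nonpos_Ints_cases)
    then show ?thesis by (simp add: rGamma_inverse_Gamma Gamma_eq_zero_iff)
  qed
  show "torus_integrable G"
    unfolding G_def by (intro torus_integral_product circle_integral_omega Re1 Re2)
  have "torus_integral G = 2 * of_real pi * \<i> * (Gamma (?\<alpha> + ?\<beta> + 1) * rGamma (?\<alpha> + 1) * rGamma (?\<beta> + 1)) *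
      (\<Prod>r\<in>UNIV. 2 * of_real pi * \<i> * (Gamma (?m r + ?n r + 1) * rGamma (?m r + 1) * rGamma (?n r + 1)))"
    unfolding G_def
    by (subst torus_integral_product(2)) (simp_all only: circle_integral_omega Re1 Re2)
  also have "(\<Prod>r\<in>UNIV. 2 * of_real pi * \<i> * (Gamma (?m r + ?n r + 1) * rGamma (?m r + 1) * rGamma (?n r + 1)))
      = (2 * of_real pi * \<i>) ^ CARD('k) * ((\<Prod>r\<in>UNIV. Gamma (?m r + ?n r + 1)) * codegree_factor m a * codegree_factor n b)"
    by (simp add: codegree_factor_def prod.distrib power_mult_distrib)
  finally have I: "torus_integral G = (2 * of_real pi * \<i>) ^ (CARD('k) + 1) *
      (Gamma (?\<alpha> + ?\<beta> + 1) * rGamma (?\<alpha> + 1) * rGamma (?\<beta> + 1) *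
       ((\<Prod>r\<in>UNIV. Gamma (?m r + ?n r + 1)) * codegree_factor m a * codegree_factor n b))"
    by (simp only: power_add power_one_right mult_ac)
  have one: "(\<Prod>r\<in>UNIV. Gamma (?m r + ?n r + 1)) * codegree_factor (m + n) (a + b) = 1"
  proof -
    have "Gamma (?m r + ?n r + 1) * rGamma (of_nat ((m + n) $ r) - of_nat ((a + b) $ r) + 1) = 1" for r
    proof -
      have eq: "of_nat ((m + n) $ r) - of_nat ((a + b) $ r) + 1 = ?m r + ?n r + 1" by simp
      show ?thesis unfolding eq by (rule Gamma_rGamma) (use Re2[of r] in simp)
    qed
    then show ?thesis unfolding codegree_factor_def prod.distrib [symmetric] by simp
  qed
  have two: "Gamma (?\<alpha> + ?\<beta> + 1) * rGamma (\<alpha> + \<beta> + 1 + of_nat (vsum (a + b))) = 1"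
  proof -
    have eq: "\<alpha> + \<beta> + 1 + of_nat (vsum (a + b)) = ?\<alpha> + ?\<beta> + 1" by (simp add: vsum_add)
    show ?thesis unfolding eq by (rule Gamma_rGamma) (use Re1 in simp)
  qed
  have arg: "?\<alpha> + 1 = \<alpha> + 1 + of_nat (vsum a)" "?\<beta> + 1 = \<beta> + 1 + of_nat (vsum b)" by simp_all
  show "rGamma (\<alpha> + \<beta> + 1 + of_nat (vsum (a + b))) * codegree_factor (m + n) (a + b) * torus_integral G
      = (2 * of_real pi * \<i>) ^ (CARD('k) + 1) *
        ((rGamma (\<alpha> + 1 + of_nat (vsum a)) * codegree_factor m a) *
         (rGamma (\<beta> + 1 + of_nat (vsum b)) * codegree_factor n b))"
  proof -
    have "R * C * (P * (G * Ra * Rb * (Q * Ca * Cb))) = P * ((Ra * Ca) * (Rb * Cb))"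
      if "Q * C = 1" "G * R = 1" for R C P G Ra Rb Q Ca Cb :: complex
      using that by algebra
    from this[OF one two] show ?thesis unfolding I arg .
  qed
qed

theorem theorem4p1:
  fixes m n :: "nat ^ 'k" and x y :: "complex ^ 'k" and \<alpha> \<beta> :: complex
  assumes "Re (\<alpha> + \<beta>) > -1"
  defines "F \<equiv> \<lambda>(u :: complex) (z :: complex ^ 'k).
     omega \<alpha> \<beta> u * (\<Prod>r\<in>UNIV. omega (of_nat (m $ r)) (of_nat (n $ r)) (z $ r)) *
     (Laguerre (\<alpha> + \<beta>) (m + n) (xi_tilde x u z + eta_tilde y u z) *
      rGamma (\<alpha> + \<beta> + of_nat (vsum (m + n)) + 1))"
  shows "torus_integrable F \<and>
     (Laguerre \<alpha> m x * rGamma (\<alpha> + 1 + of_nat (vsum m))) *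
     (Laguerre \<beta> n y * rGamma (\<beta> + 1 + of_nat (vsum n)))
     = 1 / (2 * of_real pi * \<i>) ^ (CARD('k) + 1) * torus_integral F"
proof -
  let ?S = "{(a, b). a + b \<in> multi_le (m + n)}"
  let ?P = "(2 * of_real pi * \<i>) ^ (CARD('k) + 1) :: complex"
  define c where "c = (\<lambda>(a, b). rGamma (\<alpha> + \<beta> + 1 + of_nat (vsum (a + b))) * codegree_factor (m + n) (a + b) *
      (divided_power (- x) a * divided_power (- y) b))"
  define G where "G = (\<lambda>(a, b) u (z :: complex ^ 'k). omega (\<alpha> + of_nat (vsum a)) (\<beta> + of_nat (vsum b)) u *
     (\<Prod>r\<in>UNIV. omega (of_nat (m $ r) - of_nat (a $ r)) (of_nat (n $ r) - of_nat (b $ r)) (z $ r)))"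
  define h where "h \<gamma> n x a = rGamma (\<gamma> + 1 + of_nat (vsum a)) * divided_power (- x) a * codegree_factor n a"
    for \<gamma> :: complex and n a :: "nat ^ 'k" and x :: "complex ^ 'k"
  have bij: "bij_betw (\<lambda>(j, a). (a, j - a)) (Sigma (multi_le (m + n)) multi_le) ?S"
    by (rule bij_betw_byWitness[where f' = "\<lambda>(a, b). (a + b, a)"])
       (auto simp: vec_eq_iff)
  have "finite (Sigma (multi_le (m + n)) multi_le)" by (intro finite_SigmaI finite_multi_le)
  then have finS: "finite ?S" using bij_betw_finite[OF bij] by simp
  have F_eq: "F u z = (\<Sum>p\<in>?S. c p * G p u z)"
    if u: "norm u = 1" and z: "\<And>r. norm (z $ r) = 1" for u and z :: "complex ^ 'k"
  proof -
    let ?\<omega> = "omega \<alpha> \<beta> u * (\<Prod>r\<in>UNIV. omega (of_nat (m $ r)) (of_nat (n $ r)) (z $ r))"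
    let ?\<xi> = "xi_tilde x u z" and ?\<eta> = "eta_tilde y u z"
    let ?R = "\<lambda>j. rGamma (\<alpha> + \<beta> + 1 + of_nat (vsum j)) * codegree_factor (m + n) j"
    have arg: "\<alpha> + \<beta> + of_nat (vsum (m + n)) + 1 = \<alpha> + \<beta> + 1 + of_nat (vsum (m + n))" by simp
    have neg: "- (?\<xi> + ?\<eta>) = - ?\<xi> + - ?\<eta>" by simp
    have "F u z = ?\<omega> * (\<Sum>j\<in>multi_le (m + n). \<Sum>a\<in>multi_le j.
        ?R j * (divided_power (- ?\<xi>) a * divided_power (- ?\<eta>) (j - a)))"
      unfolding F_def arg Laguerre_rGamma neg divided_power_add
      by (simp only: sum_distrib_left sum_distrib_right mult_ac)
    also have "\<dots> = (\<Sum>(j, a)\<in>Sigma (multi_le (m + n)) multi_le.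
        ?\<omega> * (?R j * (divided_power (- ?\<xi>) a * divided_power (- ?\<eta>) (j - a))))"
      using finite_multi_le[of "m + n"]
      by (subst sum.Sigma) (simp_all add: sum_distrib_left finite_multi_le case_prod_unfold)
    also have "\<dots> = (\<Sum>(j, a)\<in>Sigma (multi_le (m + n)) multi_le. c (a, j - a) * G (a, j - a) u z)"
    proof (rule sum.cong[OF refl])
      fix p assume "p \<in> Sigma (multi_le (m + n)) multi_le"
      then obtain j a where p: "p = (j, a)" and "a \<in> multi_le j" by (rule SigmaE)
      then have "a + (j - a) = j" by (simp add: vec_eq_iff)
      then show "(case p of (j, a) \<Rightarrow> ?\<omega> * (?R j * (divided_power (- ?\<xi>) a * divided_power (- ?\<eta>) (j - a))))
          = (case p of (j, a) \<Rightarrow> c (a, j - a) * G (a, j - a) u z)"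
        using integrand_monomial[OF u z, of \<alpha> \<beta> m n x a y "j - a"]
        unfolding p c_def G_def by (simp add: mult_ac)
    qed
    also have "\<dots> = (\<Sum>p\<in>?S. c p * G p u z)"
      using sum.reindex_bij_betw[OF bij, of "\<lambda>p. c p * G p u z"] by (simp add: case_prod_beta)
    finally show ?thesis .
  qed
  have G_int: "torus_integrable (G p)" if "p \<in> ?S" for p
    using that torus_integral_monomial(1)[OF assms(1)] by (cases p) (auto simp: G_def)
  have "torus_integral F = (\<Sum>p\<in>?S. c p * torus_integral (G p))"
    by (rule torus_integral_sum(2)[OF G_int F_eq])
  also have "\<dots> = (\<Sum>(a, b)\<in>?S. ?P * (h \<alpha> m x a * h \<beta> n y b))"
  proof (rule sum.cong[OF refl])
    fix p assume "p \<in> ?S"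
    then obtain a b where p: "p = (a, b)" and ab: "a + b \<in> multi_le (m + n)" by blast
    from arg_cong[OF torus_integral_monomial(2)[OF assms(1) ab], of "\<lambda>t. t * (divided_power (- x) a * divided_power (- y) b)"]
    show "c p * torus_integral (G p) = (case p of (a, b) \<Rightarrow> ?P * (h \<alpha> m x a * h \<beta> n y b))"
      unfolding p c_def G_def h_def split by (simp only: mult_ac)
  qed
  \<comment> \<open>The integrals over the variables \<open>z\<^sub>r\<close> vanish unless \<open>a \<le> m\<close> and \<open>b \<le> n\<close>, which decouples the sum.\<close>
  also have "\<dots> = (\<Sum>(a, b)\<in>multi_le m \<times> multi_le n. ?P * (h \<alpha> m x a * h \<beta> n y b))"
  proof (rule sum.mono_neutral_right[OF finS])
    show "multi_le m \<times> multi_le n \<subseteq> ?S"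
      by (auto simp: add_mono)
    show "\<forall>p\<in>?S - multi_le m \<times> multi_le n. (case p of (a, b) \<Rightarrow> ?P * (h \<alpha> m x a * h \<beta> n y b)) = 0"
      by (auto simp: h_def dest: codegree_factor_support)
  qed
  also have "\<dots> = ?P * ((\<Sum>a\<in>multi_le m. h \<alpha> m x a) * (\<Sum>b\<in>multi_le n. h \<beta> n y b))"
    by (subst sum_product, subst sum.cartesian_product) (simp only: sum_distrib_left case_prod_unfold)
  finally have "torus_integral F = ?P * ((Laguerre \<alpha> m x * rGamma (\<alpha> + 1 + of_nat (vsum m))) *
     (Laguerre \<beta> n y * rGamma (\<beta> + 1 + of_nat (vsum n))))"
    unfolding Laguerre_rGamma h_def .
  moreover have "torus_integrable F"
    by (rule torus_integral_sum(1)[OF G_int F_eq])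
  moreover have "?P \<noteq> 0" by simp
  ultimately show ?thesis by simp
qed

end
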